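(* Let $G$ be an operator system with unit $1$ and let $\Omega$ be an open fully matricial $G$-set. Then the map $\partial_1:\mathcal{F}^{(1)}(\Omega:\mathbb{C})\to\mathcal{F}^{(2)}(\Omega;\Omega:\mathbb{C})$ is an extension of Voiculescu's derivation $\partial:A(\Omega)\to A(\Omega;\Omega)$; that is, $\partial_1f=\partial f$ for every $f\in A(\Omega)\subset\mathcal{F}^{(1)}(\Omega:\mathbb{C})$. (Equivalently, the operator $\Delta_1$ is an extension of the operator $\nabla$.)
   Context: An operator system $G$ is a $*$-closed subspace, containing the unit $1$, of a unital C*-algebra; $M_n(G)=M_n(\mathbb{C})\otimes G$ carries the norm inherited from the C*-algebra of $n\times n$ matrices. An open fully matricial $G$-set is $\Omega=(\Omega_n)_{n\ge1}$ with $\Omega_n\subset M_n(G)$ open, $\Omega_m\oplus\Omega_n=\Omega_{m+n}\cap(M_m(G)\oplus M_n(G))$, and $(s\otimes1)\Omega_n(s\otimes1)^{-1}=\Omega_n$ for $s\in GL_n(\mathbb{C})$. It is right admissible: for $X\in\Omega_n$, $Y\in\Omega_m$, $Z\in M_{n,m}(G)$ there is $r\in\mathbb{C}\setminus\{0\}$ with $\left[\begin{smallmatrix}X&rZ\\0&Y\end{smallmatrix}\right]\in\Omega_{n+m}$. $\mathcal{F}^{(1)}(\Omega:\mathbb{C})$: families $f=(f_n)$ of maps $f_n:\Omega_n\to M_n(\mathbb{C})$ with $f_{m+n}(X\oplus Y)=f_m(X)\oplus f_n(Y)$ and $f_n((s\otimes1)X(s\otimes1)^{-1})=sf_n(X)s^{-1}$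 (no analyticity required). $\mathcal{F}^{(2)}(\Omega;\Omega:\mathbb{C})$: families of maps $f_{n;m}:\Omega_n\times\Omega_m\to M_n(\mathbb{C})\otimes M_m(\mathbb{C})$ with these properties in each variable separately (acting on the corresponding tensor leg). $A(\Omega)$ and $A(\Omega;\Omega)$ are the subspaces of families of analytic maps. nc difference-differential operator: for $f\in\mathcal{F}^{(1)}(\Omega:\mathbb{C})$, $X\in\Omega_n$, $Y\in\Omega_m$, $Z\in M_{n,m}(G)$, choose $r\ne0$ with $\left[\begin{smallmatrix}X&rZ\\0&Y\end{smallmatrix}\right]\in\Omega_{n+m}$; then $f_{n+m}\big(\left[\begin{smallmatrix}X&rZ\\0&Y\end{smallmatrix}\right]\big)=\left[\begin{smallmatrix}f_n(X)&r(\Delta f)(X,Y)(Z)\\0&f_m(Y)\end{smallmatrix}\right]$ defines $(\Delta f)(X,Y)(Z)\in M_{n,m}(\mathbb{C})$ independently of $r$, and it is linear in $Z$. For $a\in G$ and $\gamma\in M_{n,m}(\mathbb{C})$, $(\Delta_af)(X,Y)(\gamma)=(\Delta f)(X,Y)(\gamma\otimes a)$. $\partial_af\in\mathcal{F}^{(2)}(\Omega;\Omega:\mathbb{C})$ is the family for which $(\partial_af)_{n;m}(X;Y)\in M_n(\mathbb{C})\otimes M_m(\mathbb{C})$ is the unique element with $(\partial_af)_{n;m}(X;Y)\#\gamma=(\Delta_af)(X,Y)(\gamma)$ for all $\gamma$, where $(A\otimes C)\#\gamma=A\gamma C$. $\partial_1$, $\Delta_1$ are the case $a=1$. Voiculescu's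 operators, for $f\in A(\Omega)$: $(\nabla f)_{n;m}(X;Y)(\gamma)$ is the upper-right $n\times m$ block of $\tfrac{d}{d\epsilon}f_{n+m}\big(\left[\begin{smallmatrix}X&\epsilon(\gamma\otimes1)\\0&Y\end{smallmatrix}\right]\big)\big|_{\epsilon=0}$, and $(\partial f)_{n;m}(X;Y)=\sum_{1\le a,b\le n,\,1\le c,d\le m}\big((\nabla f)_{n;m}(X;Y)(e^{(n,m)}_{b,c})\big)_{(a,d)}e^{(n)}_{a,b}\otimes e^{(m)}_{c,d}$ ($e$'s are matrix units). *)

theory Defs
  imports "HOL-Analysis.Derivative" "Jordan_Normal_Form.Matrix"
begin

section \<open>Unital C*-algebras and operator systems\<close>

class unital_cstar_algebra = banach + real_normed_algebra_1 +
  fixes scaleC :: "complex \<Rightarrow> 'a \<Rightarrow> 'a"  (infixr \<open>*\<^sub>C\<close> 75)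
    and star :: "'a \<Rightarrow> 'a"
  assumes scaleC_add_right: "c *\<^sub>C (x + y) = c *\<^sub>C x + c *\<^sub>C y"
    and scaleC_add_left: "(c + d) *\<^sub>C x = c *\<^sub>C x + d *\<^sub>C x"
    and scaleC_scaleC: "c *\<^sub>C d *\<^sub>C x = (c * d) *\<^sub>C x"
    and scaleC_of_real: "complex_of_real r *\<^sub>C x = r *\<^sub>R x"
    and scaleC_mult_left: "(c *\<^sub>C x) * y = c *\<^sub>C (x * y)"
    and scaleC_mult_right: "x * (c *\<^sub>C y) = c *\<^sub>C (x * y)"
    and norm_scaleC: "norm (c *\<^sub>C x) = cmod c * norm x"
    and star_star: "star (star x) = x"
    and star_add: "star (x + y) = star x + star y"
    and star_mult: "star (x * y) = star y * star x"
    and star_scaleC: "star (c *\<^sub>C x) = cnj c *\<^sub>C star x"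
    and norm_star_mult: "norm (star x * x) = (norm x)\<^sup>2"

instantiation complex :: unital_cstar_algebra
begin
definition "scaleC_complex (c::complex) (x::complex) = c * x"
definition "star_complex = cnj"
instance
  by standard
    (simp_all add: scaleC_complex_def star_complex_def algebra_simps norm_mult
      scaleR_conv_of_real power2_eq_square)
end

definition operator_system :: "'a::unital_cstar_algebra set \<Rightarrow> bool" where
  "operator_system G \<longleftrightarrow> 1 \<in> G \<and> (\<forall>x\<in>G. \<forall>y\<in>G. x + y \<in> G) \<and>
     (\<forall>c. \<forall>x\<in>G. c *\<^sub>C x \<in> G) \<and> (\<forall>x\<in>G. star x \<in> G)"


section \<open>Matrices over an operator system\<close>

definition mats :: "'a::unital_cstar_algebra set \<Rightarrow> nat \<Rightarrow> nat \<Rightarrow> 'a mat set" where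
  "mats G n m = {X \<in> carrier_mat n m. elements_mat X \<subseteq> G}"

definition mat_scaleC :: "complex \<Rightarrow> 'a::unital_cstar_algebra mat \<Rightarrow> 'a mat" where
  "mat_scaleC c X = map_mat (\<lambda>x. c *\<^sub>C x) X"

definition mat_star :: "'a::unital_cstar_algebra mat \<Rightarrow> 'a mat" where
  "mat_star X = mat (dim_col X) (dim_row X) (\<lambda>(i, j). star (X $$ (j, i)))"

text \<open>The elementary tensor of a scalar matrix and an algebra element, under the identification
  of the tensor product of scalar matrices and the algebra with matrices over the algebra.\<close>
definition amp :: "complex mat \<Rightarrow> 'a::unital_cstar_algebra \<Rightarrow> 'a mat" where
  "amp s a = map_mat (\<lambda>c. c *\<^sub>C a) s"

text \<open>\<open>N\<close> restricts, for every size \<open>n \<ge> 1\<close>, to a norm making the *-algebra of \<open>n\<close> by \<open>n\<close> matrices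
  a C*-algebra.  A *-algebra carries at most one such norm and matrix algebras over C*-algebras
  carry one, so this pins down \<open>N\<close> on all nonempty square matrices.  (A single function suffices
  because matrices know their dimensions.)\<close>
definition cstar_matrix_norm :: "('a::unital_cstar_algebra mat \<Rightarrow> real) \<Rightarrow> bool" where
  "cstar_matrix_norm N \<longleftrightarrow> (\<forall>n\<ge>1.
     (\<forall>X\<in>carrier_mat n n. 0 \<le> N X \<and> (N X = 0 \<longleftrightarrow> X = 0\<^sub>m n n)) \<and>
     (\<forall>X\<in>carrier_mat n n. \<forall>Y\<in>carrier_mat n n. N (X + Y) \<le> N X + N Y) \<and>
     (\<forall>c. \<forall>X\<in>carrier_mat n n. N (mat_scaleC c X) = cmod c * N X) \<and>
     (\<forall>X\<in>carrier_mat n n. \<forall>Y\<in>carrier_mat n n. N (X * Y) \<le> N X * N Y) \<and>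
     (\<forall>X\<in>carrier_mat n n. N (mat_star X * X) = (N X)\<^sup>2) \<and>
     (\<forall>S. (\<forall>k. S k \<in> carrier_mat n n) \<and>
          (\<forall>e>0. \<exists>K::nat. \<forall>k\<ge>K. \<forall>l\<ge>K. N (S k - S l) < e) \<longrightarrow>
          (\<exists>L\<in>carrier_mat n n. (\<lambda>k. N (S k - L)) \<longlonglongrightarrow> 0)))"

definition upper_tri :: "'b::zero mat \<Rightarrow> 'b mat \<Rightarrow> 'b mat \<Rightarrow> 'b mat" where
  "upper_tri X Z Y = four_block_mat X Z (0\<^sub>m (dim_row Y) (dim_col X)) Y"

definition dsum :: "'b::zero mat \<Rightarrow> 'b mat \<Rightarrow> 'b mat"  (infixl \<open>\<oplus>\<^sub>d\<close> 65) where
  "X \<oplus>\<^sub>d Y = four_block_mat X (0\<^sub>m (dim_row X) (dim_col Y)) (0\<^sub>m (dim_row Y) (dim_col X)) Y"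

definition inverse_pair :: "nat \<Rightarrow> complex mat \<Rightarrow> complex mat \<Rightarrow> bool" where
  "inverse_pair n s t \<longleftrightarrow> s \<in> carrier_mat n n \<and> t \<in> carrier_mat n n \<and>
     s * t = 1\<^sub>m n \<and> t * s = 1\<^sub>m n"

definition open_fully_matricial ::
  "('a::unital_cstar_algebra mat \<Rightarrow> real) \<Rightarrow> 'a set \<Rightarrow> (nat \<Rightarrow> 'a mat set) \<Rightarrow> bool" where
  "open_fully_matricial N G \<Omega> \<longleftrightarrow>
     (\<forall>n\<ge>1. \<Omega> n \<subseteq> mats G n n) \<and>
     (\<forall>n\<ge>1. \<forall>X\<in>\<Omega> n. \<exists>e>0. \<forall>Y\<in>mats G n n. N (Y - X) < e \<longrightarrow> Y \<in> \<Omega> n) \<and>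
     (\<forall>m\<ge>1. \<forall>n\<ge>1. {X \<oplus>\<^sub>d Y | X Y. X \<in> \<Omega> m \<and> Y \<in> \<Omega> n} =
        \<Omega> (m + n) \<inter> {X \<oplus>\<^sub>d Y | X Y. X \<in> mats G m m \<and> Y \<in> mats G n n}) \<and>
     (\<forall>n\<ge>1. \<forall>s t. inverse_pair n s t \<longrightarrow> (\<lambda>X. amp s 1 * X * amp t 1) ` \<Omega> n = \<Omega> n)"


section \<open>The tensor product of two scalar matrix algebras\<close>

text \<open>The tensor product of the \<open>n\<close> by \<open>n\<close> and the \<open>m\<close> by \<open>m\<close> scalar matrices is represented by
  \<open>carrier_mat (n * m) (n * m)\<close>, with elementary tensors as Kronecker products; the coefficient of
  the elementary tensor of the matrix units \<open>(a, b)\<close> and \<open>(c, d)\<close> is the entry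
  \<open>(a * m + c, b * m + d)\<close>.\<close>

definition tcoeff :: "nat \<Rightarrow> complex mat \<Rightarrow> nat \<Rightarrow> nat \<Rightarrow> nat \<Rightarrow> nat \<Rightarrow> complex" where
  "tcoeff m T a b c d = T $$ (a * m + c, b * m + d)"

definition tmat ::
  "nat \<Rightarrow> nat \<Rightarrow> (nat \<Rightarrow> nat \<Rightarrow> nat \<Rightarrow> nat \<Rightarrow> complex) \<Rightarrow> complex mat" where
  "tmat n m t = mat (n * m) (n * m) (\<lambda>(r, s). t (r div m) (s div m) (r mod m) (s mod m))"

lemma tmat_carrier [simp]: "tmat n m t \<in> carrier_mat (n * m) (n * m)"
  by (simp add: tmat_def)

lemma tensor_index_less: "a * m + c < n * m" if "a < n" "c < m" for a c n m :: nat
proof -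
  have "a * m + c < Suc a * m" using that by simp
  also have "\<dots> \<le> n * m" using that by (intro mult_right_mono) auto
  finally show ?thesis .
qed

lemma tcoeff_tmat:
  assumes "a < n" "b < n" "c < m" "d < m"
  shows "tcoeff m (tmat n m t) a b c d = t a b c d"
  using assms by (simp add: tcoeff_def tmat_def tensor_index_less)

definition kron :: "complex mat \<Rightarrow> complex mat \<Rightarrow> complex mat" where
  "kron A C = tmat (dim_row A) (dim_row C) (\<lambda>a b c d. A $$ (a, b) * C $$ (c, d))"

text \<open>The linear extension in \<open>T\<close> of \<open>hash n m (kron A C) \<gamma> = A * \<gamma> * C\<close>, see \<open>hash_kron\<close>.\<close>
definition hash :: "nat \<Rightarrow> nat \<Rightarrow> complex mat \<Rightarrow> complex mat \<Rightarrow> complex mat" where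
  "hash n m T \<gamma> = mat n m (\<lambda>(a, d). \<Sum>b<n. \<Sum>c<m. tcoeff m T a b c d * \<gamma> $$ (b, c))"

lemma hash_kron:
  assumes A: "A \<in> carrier_mat n n" and C: "C \<in> carrier_mat m m" and g: "\<gamma> \<in> carrier_mat n m"
  shows "hash n m (kron A C) \<gamma> = A * \<gamma> * C"
proof (rule eq_matI)
  fix a d assume "a < dim_row (A * \<gamma> * C)" "d < dim_col (A * \<gamma> * C)"
  then have a: "a < n" and d: "d < m" using assms by auto
  have "hash n m (kron A C) \<gamma> $$ (a, d)
      = (\<Sum>b<n. \<Sum>c<m. A $$ (a, b) * C $$ (c, d) * \<gamma> $$ (b, c))"
    using assms a d by (simp add: hash_def kron_def tcoeff_tmat)
  also have "\<dots> = (A * (\<gamma> * C)) $$ (a, d)"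
    using assms a d
    by (simp add: scalar_prod_def sum_distrib_left lessThan_atLeast0 mult_ac)
  also have "A * (\<gamma> * C) = A * \<gamma> * C"
    using assms by (simp add: assoc_mult_mat)
  finally show "hash n m (kron A C) \<gamma> $$ (a, d) = (A * \<gamma> * C) $$ (a, d)" .
qed (use assms in \<open>auto simp: hash_def\<close>)

text \<open>Direct sums in the left and in the right tensor leg.\<close>

definition dsum_left :: "nat \<Rightarrow> nat \<Rightarrow> nat \<Rightarrow> complex mat \<Rightarrow> complex mat \<Rightarrow> complex mat" where
  "dsum_left p q m S T = tmat (p + q) m (\<lambda>a b c d.
     if a < p \<and> b < p then tcoeff m S a b c d
     else if p \<le> a \<and> p \<le> b then tcoeff m T (a - p) (b - p) c d else 0)"

definition dsum_right :: "nat \<Rightarrow> nat \<Rightarrow> nat \<Rightarrow> complex mat \<Rightarrow> complex mat \<Rightarrow> complex mat" where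
  "dsum_right n p q S T = tmat n (p + q) (\<lambda>a b c d.
     if c < p \<and> d < p then tcoeff p S a b c d
     else if p \<le> c \<and> p \<le> d then tcoeff q T a b (c - p) (d - p) else 0)"

lemma tmat_cong:
  assumes "\<And>a b c d. a < n \<Longrightarrow> b < n \<Longrightarrow> c < m \<Longrightarrow> d < m \<Longrightarrow> t a b c d = u a b c d"
  shows "tmat n m t = tmat n m u"
proof (rule eq_matI)
  fix i j assume "i < dim_row (tmat n m u)" "j < dim_col (tmat n m u)"
  then have i: "i < n * m" and j: "j < n * m" by (auto simp: tmat_def)
  then have "m > 0" by (cases m) auto
  then show "tmat n m t $$ (i, j) = tmat n m u $$ (i, j)"
    using i j by (auto simp: tmat_def less_mult_imp_div_less intro!: assms)
qed (auto simp: tmat_def)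

lemma kron_dsum_left:
  assumes "A \<in> carrier_mat p p" "B \<in> carrier_mat q q" "C \<in> carrier_mat m m"
  shows "kron (A \<oplus>\<^sub>d B) C = dsum_left p q m (kron A C) (kron B C)"
  using assms unfolding dsum_left_def kron_def
  by (auto simp: dsum_def intro!: tmat_cong) (simp_all add: tcoeff_tmat)

lemma kron_dsum_right:
  assumes "A \<in> carrier_mat n n" "B \<in> carrier_mat p p" "C \<in> carrier_mat q q"
  shows "kron A (B \<oplus>\<^sub>d C) = dsum_right n p q (kron A B) (kron A C)"
  using assms unfolding dsum_right_def kron_def
  by (auto simp: dsum_def intro!: tmat_cong) (simp_all add: tcoeff_tmat)


section \<open>Families of fully matricial functions\<close>

type_synonym 'a family1 = "nat \<Rightarrow> 'a mat \<Rightarrow> complex mat"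
type_synonym 'a family2 = "nat \<Rightarrow> nat \<Rightarrow> 'a mat \<Rightarrow> 'a mat \<Rightarrow> complex mat"

text \<open>Values of a family outside \<open>\<Omega>\<close>, or at size \<open>0\<close>, are irrelevant junk.\<close>

definition F1 :: "(nat \<Rightarrow> 'a::unital_cstar_algebra mat set) \<Rightarrow> 'a family1 set" where
  "F1 \<Omega> = {f.
     (\<forall>n\<ge>1. \<forall>X\<in>\<Omega> n. f n X \<in> carrier_mat n n) \<and>
     (\<forall>m\<ge>1. \<forall>n\<ge>1. \<forall>X\<in>\<Omega> m. \<forall>Y\<in>\<Omega> n. f (m + n) (X \<oplus>\<^sub>d Y) = f m X \<oplus>\<^sub>d f n Y) \<and>
     (\<forall>n\<ge>1. \<forall>X\<in>\<Omega> n. \<forall>s t. inverse_pair n s t \<longrightarrow>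
        f n (amp s 1 * X * amp t 1) = s * f n X * t)}"

definition F2 :: "(nat \<Rightarrow> 'a::unital_cstar_algebra mat set) \<Rightarrow> 'a family2 set" where
  "F2 \<Omega> = {f.
     (\<forall>n\<ge>1. \<forall>m\<ge>1. \<forall>X\<in>\<Omega> n. \<forall>Y\<in>\<Omega> m. f n m X Y \<in> carrier_mat (n * m) (n * m)) \<and>
     (\<forall>p\<ge>1. \<forall>q\<ge>1. \<forall>m\<ge>1. \<forall>X\<in>\<Omega> p. \<forall>X'\<in>\<Omega> q. \<forall>Y\<in>\<Omega> m.
        f (p + q) m (X \<oplus>\<^sub>d X') Y = dsum_left p q m (f p m X Y) (f q m X' Y)) \<and>
     (\<forall>n\<ge>1. \<forall>p\<ge>1. \<forall>q\<ge>1. \<forall>X\<in>\<Omega> n. \<forall>Y\<in>\<Omega> p. \<forall>Y'\<in>\<Omega> q.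
        f n (p + q) X (Y \<oplus>\<^sub>d Y') = dsum_right n p q (f n p X Y) (f n q X Y')) \<and>
     (\<forall>n\<ge>1. \<forall>m\<ge>1. \<forall>X\<in>\<Omega> n. \<forall>Y\<in>\<Omega> m. \<forall>s t. inverse_pair n s t \<longrightarrow>
        f n m (amp s 1 * X * amp t 1) Y = kron s (1\<^sub>m m) * f n m X Y * kron t (1\<^sub>m m)) \<and>
     (\<forall>n\<ge>1. \<forall>m\<ge>1. \<forall>X\<in>\<Omega> n. \<forall>Y\<in>\<Omega> m. \<forall>s t. inverse_pair m s t \<longrightarrow>
        f n m X (amp s 1 * Y * amp t 1) = kron (1\<^sub>m n) s * f n m X Y * kron (1\<^sub>m n) t)}"

text \<open>Analyticity of a scalar function \<open>g\<close> on a relatively open subset \<open>U\<close> of a complex normed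
  space (with carrier \<open>V\<close>, addition \<open>pl\<close>, scalar multiplication \<open>sc\<close> and norm \<open>N\<close>): complex
  Frechet differentiability at every point of \<open>U\<close>.  The space is given explicitly since the matrix
  spaces are not types.\<close>
definition analytic_fun_on ::
  "'v set \<Rightarrow> ('v \<Rightarrow> 'v \<Rightarrow> 'v) \<Rightarrow> (complex \<Rightarrow> 'v \<Rightarrow> 'v) \<Rightarrow> ('v \<Rightarrow> real) \<Rightarrow> 'v set \<Rightarrow>
   ('v \<Rightarrow> complex) \<Rightarrow> bool" where
  "analytic_fun_on V pl sc N U g \<longleftrightarrow> (\<forall>x\<in>U. \<exists>D.
     (\<forall>h\<in>V. \<forall>k\<in>V. D (pl h k) = D h + D k) \<and>
     (\<forall>c. \<forall>h\<in>V. D (sc c h) = c * D h) \<and>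
     (\<exists>B. \<forall>h\<in>V. cmod (D h) \<le> B * N h) \<and>
     (\<forall>e>0. \<exists>d>0. \<forall>h\<in>V. pl x h \<in> U \<and> N h < d \<longrightarrow>
        cmod (g (pl x h) - g x - D h) \<le> e * N h))"

text \<open>A map into a finite-dimensional matrix space is analytic iff all its entries are; on a product
  of two matrix spaces the maximum norm is used.\<close>

definition A1 :: "('a::unital_cstar_algebra mat \<Rightarrow> real) \<Rightarrow> 'a set \<Rightarrow>
    (nat \<Rightarrow> 'a mat set) \<Rightarrow> 'a family1 set" where
  "A1 N G \<Omega> = {f \<in> F1 \<Omega>. \<forall>n\<ge>1. \<forall>i<n. \<forall>j<n.
     analytic_fun_on (mats G n n) (+) mat_scaleC N (\<Omega> n) (\<lambda>X. f n X $$ (i, j))}"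

definition A2 :: "('a::unital_cstar_algebra mat \<Rightarrow> real) \<Rightarrow> 'a set \<Rightarrow>
    (nat \<Rightarrow> 'a mat set) \<Rightarrow> 'a family2 set" where
  "A2 N G \<Omega> = {f \<in> F2 \<Omega>. \<forall>n\<ge>1. \<forall>m\<ge>1. \<forall>i<n * m. \<forall>j<n * m.
     analytic_fun_on (mats G n n \<times> mats G m m)
       (\<lambda>(X, Y) (X', Y'). (X + X', Y + Y'))
       (\<lambda>c (X, Y). (mat_scaleC c X, mat_scaleC c Y))
       (\<lambda>(X, Y). max (N X) (N Y))
       (\<Omega> n \<times> \<Omega> m) (\<lambda>(X, Y). f n m X Y $$ (i, j))}"


section \<open>The nc difference-differential operators\<close>

definition upper_right :: "nat \<Rightarrow> nat \<Rightarrow> complex mat \<Rightarrow> complex mat" where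
  "upper_right n m W = mat n m (\<lambda>(i, j). W $$ (i, n + j))"

definition nc_Delta :: "(nat \<Rightarrow> 'a::unital_cstar_algebra mat set) \<Rightarrow> 'a family1 \<Rightarrow>
    nat \<Rightarrow> nat \<Rightarrow> 'a mat \<Rightarrow> 'a mat \<Rightarrow> 'a mat \<Rightarrow> complex mat" where
  "nc_Delta \<Omega> f n m X Y Z =
     (let r = (SOME r. r \<noteq> 0 \<and> upper_tri X (mat_scaleC r Z) Y \<in> \<Omega> (n + m))
      in (1 / r) \<cdot>\<^sub>m upper_right n m (f (n + m) (upper_tri X (mat_scaleC r Z) Y)))"

definition nc_Delta_dir :: "(nat \<Rightarrow> 'a::unital_cstar_algebra mat set) \<Rightarrow> 'a \<Rightarrow> 'a family1 \<Rightarrow>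
    nat \<Rightarrow> nat \<Rightarrow> 'a mat \<Rightarrow> 'a mat \<Rightarrow> complex mat \<Rightarrow> complex mat" where
  "nc_Delta_dir \<Omega> a f n m X Y \<gamma> = nc_Delta \<Omega> f n m X Y (amp \<gamma> a)"

definition nc_partial ::
    "(nat \<Rightarrow> 'a::unital_cstar_algebra mat set) \<Rightarrow> 'a \<Rightarrow> 'a family1 \<Rightarrow> 'a family2" where
  "nc_partial \<Omega> a f n m X Y = (THE T. T \<in> carrier_mat (n * m) (n * m) \<and>
     (\<forall>\<gamma>\<in>carrier_mat n m. hash n m T \<gamma> = nc_Delta_dir \<Omega> a f n m X Y \<gamma>))"


section \<open>Voiculescu's operators\<close>

definition unit_mat :: "nat \<Rightarrow> nat \<Rightarrow> nat \<Rightarrow> nat \<Rightarrow> complex mat" where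
  "unit_mat n m a b = mat n m (\<lambda>(i, j). if i = a \<and> j = b then 1 else 0)"

definition voic_nabla :: "'a::unital_cstar_algebra family1 \<Rightarrow>
    nat \<Rightarrow> nat \<Rightarrow> 'a mat \<Rightarrow> 'a mat \<Rightarrow> complex mat \<Rightarrow> complex mat" where
  "voic_nabla f n m X Y \<gamma> = upper_right n m (mat (n + m) (n + m) (\<lambda>ij.
     deriv (\<lambda>\<epsilon>. f (n + m) (upper_tri X (mat_scaleC \<epsilon> (amp \<gamma> 1)) Y) $$ ij) 0))"

text \<open>The linear combination of elementary tensors of matrix units, written out entrywise since
  matrices of a fixed size are not a type and thus have no big sum operator.\<close>
definition voic_partial :: "'a::unital_cstar_algebra family1 \<Rightarrow> 'a family2" where
  "voic_partial f n m X Y = mat (n * m) (n * m) (\<lambda>rs.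
     \<Sum>a<n. \<Sum>b<n. \<Sum>c<m. \<Sum>d<m.
       voic_nabla f n m X Y (unit_mat n m b c) $$ (a, d) *
         kron (unit_mat n n a b) (unit_mat m m c d) $$ rs)"

end

theory Submission
  imports Defs
begin

text \<open>
  The argument is algebraic: a similarity-invariant family that respects direct sums respects all
  intertwiners, i.e. \<open>X S = S Y\<close> with a scalar matrix \<open>S\<close> implies \<open>f(X) S = S f(Y)\<close>
  (\<open>F1_intertwine\<close>).  Conjugating with diagonal matrices \<open>diag(c, 1)\<close> rescales
  the corner of a block upper triangular matrix, so openness of \<open>\<Omega>\<close> puts every
  \<open>[X, Z; 0, Y]\<close> with diagonal blocks \<open>X\<close>, \<open>Y\<close> in \<open>\<Omega>\<close> into
  \<open>\<Omega>\<close>, whatever the size of \<open>Z\<close> (\<open>upper_tri_Omega\<close>).  Hence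
  \<open>\<Delta>f(X, Y)(Z)\<close> is simply the corner of \<open>f([X, Z; 0, Y])\<close>, and intertwiners
  between block triangular matrices yield one naturality statement
  (\<open>upper_right_intertwine\<close>).  Linearity of \<open>\<Delta>\<^sub>1 f(X, Y)(\<gamma>) = \<Delta>f(X, Y)(\<gamma> \<otimes> 1)\<close> in
  \<open>\<gamma>\<close>, compatibility with direct sums and compatibility with similarities in each variable are
  all instances of it, which gives
  \<open>\<partial>\<^sub>1 f \<in> F2 \<Omega>\<close>.

  By homogeneity, the corner of \<open>f([X, \<epsilon>(\<gamma> \<otimes> 1); 0, Y])\<close> is
  \<open>\<epsilon> \<Delta>\<^sub>1 f(X, Y)(\<gamma>)\<close> for every complex \<open>\<epsilon>\<close>,
  so its derivative at \<open>0\<close> is \<open>\<Delta>\<^sub>1 f(X, Y)(\<gamma>)\<close>.  Thus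
  \<open>\<nabla>f = \<Delta>\<^sub>1 f\<close> and, comparing tensor coefficients,
  \<open>\<partial>f = \<partial>\<^sub>1 f\<close>.

  For analytic \<open>f\<close>, each entry of \<open>\<partial>f(X, Y)\<close> is an entry of
  \<open>f([X, Z; 0, Y])\<close> with a fixed \<open>Z\<close>, hence jointly differentiable in
  \<open>(X, Y)\<close> once \<open>N(X \<oplus> Y) \<le> max(N(X), N(Y))\<close> is known.  As the matrix norm is
  given only by the C*-axioms at each size, this is proved from them (\<open>N_dsum\<close>): a self-adjoint
  matrix \<open>H\<close> of norm less than 1 is the real part of the unitary
  \<open>H + i (1 - H\<^sup>2)\<^bsup>1/2\<^esup>\<close>, so the direct sum of two such matrices is the real part
  of a direct sum of unitaries and has norm at most 1.
\<close>

section \<open>Complex scalars and amplifications\<close>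

lemma scaleC_zero_left [simp]: "0 *\<^sub>C x = (0::'a::unital_cstar_algebra)"
  using scaleC_of_real[of 0 x] by simp

lemma scaleC_zero_right [simp]: "c *\<^sub>C 0 = (0::'a::unital_cstar_algebra)"
  using norm_scaleC[of c "0::'a"] by simp

lemma scaleC_one [simp]: "1 *\<^sub>C x = (x::'a::unital_cstar_algebra)"
  using scaleC_of_real[of 1 x] by simp

lemma scaleC_minus_left: "(- c) *\<^sub>C x = - (c *\<^sub>C (x::'a::unital_cstar_algebra))"
  using scaleC_add_left[of "- c" c x] by (simp add: eq_neg_iff_add_eq_0)

lemma scaleC_sum_left: "(\<Sum>i\<in>I. c i) *\<^sub>C x = (\<Sum>i\<in>I. c i *\<^sub>C (x::'a::unital_cstar_algebra))"
  by (induction I rule: infinite_finite_induct) (auto simp: scaleC_add_left)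

lemma mat_scaleC_carrier [simp]:
  "mat_scaleC c X \<in> carrier_mat n m \<longleftrightarrow> X \<in> carrier_mat n m"
  "dim_row (mat_scaleC c X) = dim_row X" "dim_col (mat_scaleC c X) = dim_col X"
  by (auto simp: mat_scaleC_def)

lemma amp_carrier [simp]:
  "amp s a \<in> carrier_mat n m \<longleftrightarrow> s \<in> carrier_mat n m"
  "dim_row (amp s a) = dim_row s" "dim_col (amp s a) = dim_col s"
  by (auto simp: amp_def)

lemma amp_index [simp]: "i < dim_row s \<Longrightarrow> j < dim_col s \<Longrightarrow> amp s a $$ (i, j) = s $$ (i, j) *\<^sub>C a"
  by (simp add: amp_def)

lemma mat_scaleC_index [simp]:
  "i < dim_row X \<Longrightarrow> j < dim_col X \<Longrightarrow> mat_scaleC c X $$ (i, j) = c *\<^sub>C X $$ (i, j)"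
  by (simp add: mat_scaleC_def)

lemma amp_mult:
  fixes a :: "'a::unital_cstar_algebra"
  assumes "S \<in> carrier_mat n k" "T \<in> carrier_mat k m"
  shows "amp (S * T) a = amp S 1 * amp T a"
  using assms
  by (auto intro!: eq_matI sum.cong simp: scalar_prod_def scaleC_sum_left scaleC_mult_left scaleC_mult_right scaleC_scaleC mult.commute)

lemma amp_one [simp]: "amp (1\<^sub>m n) 1 = (1\<^sub>m n :: 'a::unital_cstar_algebra mat)"
  by (auto intro!: eq_matI)

lemma amp_zero [simp]: "amp (0\<^sub>m n m) a = (0\<^sub>m n m :: 'a::unital_cstar_algebra mat)"
  by (auto intro!: eq_matI)

lemma amp_smult: "amp (c \<cdot>\<^sub>m S) a = mat_scaleC c (amp S a)"
  by (auto intro!: eq_matI simp: scaleC_scaleC)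

lemma amp_uminus: "amp (- S) a = - amp S a"
  by (auto intro!: eq_matI simp: scaleC_minus_left)

lemma amp_four_block:
  assumes "A \<in> carrier_mat n1 m1" "B \<in> carrier_mat n1 m2" "C \<in> carrier_mat n2 m1" "D \<in> carrier_mat n2 m2"
  shows "amp (four_block_mat A B C D) a = four_block_mat (amp A a) (amp B a) (amp C a) (amp D a)"
  unfolding amp_def using assms by (intro map_four_block_mat)

lemma mats_iff: "X \<in> mats G n m \<longleftrightarrow> X \<in> carrier_mat n m \<and> (\<forall>i<n. \<forall>j<m. X $$ (i, j) \<in> G)"
  by (auto simp: mats_def)

lemma operator_system_scaleC: "operator_system G \<Longrightarrow> x \<in> G \<Longrightarrow> c *\<^sub>C x \<in> G"
  by (simp add: operator_system_def)

lemma operator_system_zero: "operator_system G \<Longrightarrow> 0 \<in> G"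
  using operator_system_scaleC[of G 1 0] by (simp add: operator_system_def)

lemma amp_one_mats: "operator_system G \<Longrightarrow> S \<in> carrier_mat n m \<Longrightarrow> amp S 1 \<in> mats G n m"
  by (auto simp: mats_iff operator_system_def)

lemma mat_scaleC_mats: "operator_system G \<Longrightarrow> X \<in> mats G n m \<Longrightarrow> mat_scaleC c X \<in> mats G n m"
  by (auto simp: mats_iff operator_system_def)

lemma upper_tri_carrier [simp]:
  "X \<in> carrier_mat n n \<Longrightarrow> Y \<in> carrier_mat m m \<Longrightarrow> upper_tri X Z Y \<in> carrier_mat (n + m) (n + m)"
  by (auto simp: upper_tri_def)

lemma upper_tri_mats:
  "\<lbrakk>operator_system G; X \<in> mats G n n; Y \<in> mats G m m; Z \<in> mats G n m\<rbrakk>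
    \<Longrightarrow> upper_tri X Z Y \<in> mats G (n + m) (n + m)"
  by (auto simp: mats_iff upper_tri_def operator_system_zero)

lemma dsum_eq_upper_tri:
  "X \<in> carrier_mat n n \<Longrightarrow> Y \<in> carrier_mat m m \<Longrightarrow> X \<oplus>\<^sub>d Y = upper_tri X (0\<^sub>m n m) Y"
  by (auto simp: upper_tri_def dsum_def)

lemma dsum_carrier [simp]:
  "X \<in> carrier_mat n m \<Longrightarrow> Y \<in> carrier_mat k l \<Longrightarrow> X \<oplus>\<^sub>d Y \<in> carrier_mat (n + k) (m + l)"
  by (auto simp: dsum_def)

text \<open>A similarity \<open>s\<close> intertwines \<open>s X t\<close>, where \<open>t\<close> is the inverse of \<open>s\<close>, with \<open>X\<close>.\<close>

lemma similar_intertwines: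
  fixes X :: "'a::unital_cstar_algebra mat"
  assumes X: "X \<in> carrier_mat n n" and inv: "inverse_pair n s t"
  shows "(amp s 1 * X * amp t 1) * amp s 1 = amp s 1 * X"
proof -
  have st: "s \<in> carrier_mat n n" "t \<in> carrier_mat n n" "t * s = 1\<^sub>m n"
    using inv by (auto simp: inverse_pair_def)
  have a: "amp s 1 \<in> carrier_mat n n" "amp t 1 \<in> carrier_mat n n" using st by auto
  have "amp (t * s) 1 = amp t 1 * (amp s 1 :: 'a mat)" by (rule amp_mult[OF st(2,1)])
  then have "amp t 1 * amp s 1 = (1\<^sub>m n :: 'a mat)" using st(3) by simp
  then show ?thesis
    using X mult_carrier_mat[OF a(1) X] assoc_mult_mat[OF mult_carrier_mat[OF a(1) X] a(2) a(1)]
    by simp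
qed

section \<open>The norm of a direct sum\<close>

lemma star_zero [simp]: "star (0::'a::unital_cstar_algebra) = 0"
  using star_add[of 0 "0::'a"] by simp

lemma star_one [simp]: "star (1::'a::unital_cstar_algebra) = 1"
  using star_mult[of "star 1" "1::'a"] by (simp add: star_star)

lemma star_minus: "star (x - y) = star x - star (y::'a::unital_cstar_algebra)"
  using star_add[of "x - y" y] by (simp add: eq_diff_eq)

lemma star_sum: "star (\<Sum>i\<in>I. g i) = (\<Sum>i\<in>I. star (g i :: 'a::unital_cstar_algebra))"
  by (induction I rule: infinite_finite_induct) (auto simp: star_add)

lemma dim_mat_star [simp]: "dim_row (mat_star X) = dim_col X" "dim_col (mat_star X) = dim_row X"
  by (simp_all add: mat_star_def)

lemma mat_star_carrier [simp]: "mat_star X \<in> carrier_mat n m \<longleftrightarrow> X \<in> carrier_mat m n"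
  unfolding carrier_mat_def mem_Collect_eq dim_mat_star by (rule conj_commute)

lemma mat_star_index [simp]:
  "i < dim_col X \<Longrightarrow> j < dim_row X \<Longrightarrow> mat_star X $$ (i, j) = star (X $$ (j, i))"
  by (simp add: mat_star_def)

lemma mat_star_star [simp]: "mat_star (mat_star X) = X"
  by (auto simp: star_star)

lemma mat_star_one [simp]: "mat_star (1\<^sub>m n) = 1\<^sub>m n"
  by (rule eq_matI) auto

lemma mat_star_zero [simp]: "mat_star (0\<^sub>m n m) = 0\<^sub>m m n"
  by (rule eq_matI) auto

lemma mat_star_add:
  "A \<in> carrier_mat n m \<Longrightarrow> B \<in> carrier_mat n m \<Longrightarrow> mat_star (A + B) = mat_star A + mat_star B"
  by (intro eq_matI) (auto simp: star_add)

lemma mat_star_minus: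
  "A \<in> carrier_mat n m \<Longrightarrow> B \<in> carrier_mat n m \<Longrightarrow> mat_star (A - B) = mat_star A - mat_star B"
  by (intro eq_matI) (auto simp: star_minus)

lemma mat_star_scaleC: "mat_star (mat_scaleC c A) = mat_scaleC (cnj c) (mat_star A)"
  by (intro eq_matI) (auto simp: star_scaleC)

lemma mat_star_mult:
  "A \<in> carrier_mat n k \<Longrightarrow> B \<in> carrier_mat k m \<Longrightarrow> mat_star (A * B) = mat_star B * mat_star A"
  by (intro eq_matI) (auto simp: scalar_prod_def star_sum star_mult)

lemma mat_star_dsum: "mat_star (A \<oplus>\<^sub>d B) = mat_star A \<oplus>\<^sub>d mat_star B"
  by (intro eq_matI) (auto simp: dsum_def)

lemma mat_scaleC_mult:
  "A \<in> carrier_mat n k \<Longrightarrow> B \<in> carrier_mat k m \<Longrightarrow> mat_scaleC c A * B = mat_scaleC c (A * B)"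
  "A \<in> carrier_mat n k \<Longrightarrow> B \<in> carrier_mat k m \<Longrightarrow> A * mat_scaleC c B = mat_scaleC c (A * B)"
  for A B :: "'a::unital_cstar_algebra mat"
proof -
  have *: "c *\<^sub>C (\<Sum>i\<in>I. g i) = (\<Sum>i\<in>I. c *\<^sub>C g i)" for g :: "nat \<Rightarrow> 'a" and I
    by (induction I rule: infinite_finite_induct) (auto simp: scaleC_add_right)
  show "A \<in> carrier_mat n k \<Longrightarrow> B \<in> carrier_mat k m \<Longrightarrow> mat_scaleC c A * B = mat_scaleC c (A * B)"
    "A \<in> carrier_mat n k \<Longrightarrow> B \<in> carrier_mat k m \<Longrightarrow> A * mat_scaleC c B = mat_scaleC c (A * B)"
    by (auto intro!: eq_matI sum.cong simp: scalar_prod_def * scaleC_mult_left scaleC_mult_right)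
qed

lemma mat_scaleC_half: "A \<in> carrier_mat n m \<Longrightarrow> mat_scaleC (1/2) A + mat_scaleC (1/2) A = A"
  by (intro eq_matI) (auto simp: scaleC_add_left[symmetric])

lemma mat_scaleC_scaleC [simp]: "mat_scaleC c (mat_scaleC d A) = mat_scaleC (c * d) A"
  by (intro eq_matI) (auto simp: scaleC_scaleC)

lemma mat_scaleC_one [simp]: "mat_scaleC 1 A = A"
  by (intro eq_matI) auto

lemma mult_dsum:
  fixes A B :: "'b::semiring_0 mat"
  assumes "A \<in> carrier_mat n n" "A' \<in> carrier_mat n n" "B \<in> carrier_mat m m" "B' \<in> carrier_mat m m"
  shows "(A \<oplus>\<^sub>d B) * (A' \<oplus>\<^sub>d B') = (A * A') \<oplus>\<^sub>d (B * B')"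
  using assms unfolding dsum_def
  by (subst mult_four_block_mat[of _ n n _ m _ m _ _ n _ m]) auto

lemma mult_square_commute:
  fixes A C :: "'b::semiring_0 mat"
  assumes "C \<in> carrier_mat n n" "A \<in> carrier_mat n n" "C * A = A * C"
  shows "C * (A * A) = (A * A) * C"
proof -
  have "C * (A * A) = (C * A) * A" using assms(1,2) by simp
  also have "\<dots> = A * (C * A)" by (subst assms(3)) (use assms(1,2) in simp)
  also have "\<dots> = (A * A) * C" by (subst assms(3)) (use assms(1,2) in simp)
  finally show ?thesis .
qed

text \<open>A function that is a C*-norm on the square matrices of each size \<open>n \<ge> 1\<close>; no relation between
  different sizes is assumed.\<close>

locale matrix_cstar_norm =
  fixes N :: "'a::unital_cstar_algebra mat \<Rightarrow> real"
  assumes Nnorm: "cstar_matrix_norm N"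
begin

context
  fixes n :: nat
  assumes n: "n \<ge> 1"
begin

lemmas cstar_axioms = Nnorm[unfolded cstar_matrix_norm_def, THEN spec, THEN mp, OF n]

lemma N_nonneg: "A \<in> carrier_mat n n \<Longrightarrow> 0 \<le> N A"
  using cstar_axioms[THEN conjunct1] by blast

lemma N_eq_0: "A \<in> carrier_mat n n \<Longrightarrow> N A = 0 \<longleftrightarrow> A = 0\<^sub>m n n"
  using cstar_axioms[THEN conjunct1] by blast

lemma N_add: "A \<in> carrier_mat n n \<Longrightarrow> B \<in> carrier_mat n n \<Longrightarrow> N (A + B) \<le> N A + N B"
  using cstar_axioms[THEN conjunct2, THEN conjunct1] by blast

lemma N_scaleC: "A \<in> carrier_mat n n \<Longrightarrow> N (mat_scaleC c A) = cmod c * N A"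
  using cstar_axioms[THEN conjunct2, THEN conjunct2, THEN conjunct1] by blast

lemma N_mult: "A \<in> carrier_mat n n \<Longrightarrow> B \<in> carrier_mat n n \<Longrightarrow> N (A * B) \<le> N A * N B"
  using cstar_axioms[THEN conjunct2, THEN conjunct2, THEN conjunct2, THEN conjunct1] by blast

lemma N_cstar: "A \<in> carrier_mat n n \<Longrightarrow> N (mat_star A * A) = (N A)\<^sup>2"
  using cstar_axioms[THEN conjunct2, THEN conjunct2, THEN conjunct2, THEN conjunct2, THEN conjunct1] by blast

lemma N_complete:
  assumes "\<And>k. S k \<in> carrier_mat n n" "\<And>e. e > 0 \<Longrightarrow> \<exists>K::nat. \<forall>k\<ge>K. \<forall>l\<ge>K. N (S k - S l) < e"
  obtains L where "L \<in> carrier_mat n n" "(\<lambda>k. N (S k - L)) \<longlonglongrightarrow> 0"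
  using cstar_axioms[THEN conjunct2, THEN conjunct2, THEN conjunct2, THEN conjunct2, THEN conjunct2,
      THEN spec[of _ S]] assms by auto

lemma N_diff: "A \<in> carrier_mat n n \<Longrightarrow> B \<in> carrier_mat n n \<Longrightarrow> N (A - B) \<le> N A + N B"
proof -
  assume a: "A \<in> carrier_mat n n" "B \<in> carrier_mat n n"
  have "A - B = A + mat_scaleC (- 1) B"
    using a by (intro eq_matI) (auto simp: scaleC_minus_left)
  then show ?thesis using a N_add[of A "mat_scaleC (- 1) B"] by (simp add: N_scaleC)
qed

lemma N_diff_commute: "A \<in> carrier_mat n n \<Longrightarrow> B \<in> carrier_mat n n \<Longrightarrow> N (A - B) = N (B - A)"
proof -
  assume a: "A \<in> carrier_mat n n" "B \<in> carrier_mat n n"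
  have "A - B = mat_scaleC (- 1) (B - A)"
    using a by (intro eq_matI) (auto simp: scaleC_minus_left)
  then show ?thesis using a by (simp add: N_scaleC minus_carrier_mat)
qed

lemma N_triangle:
  assumes "A \<in> carrier_mat n n" "B \<in> carrier_mat n n" "C \<in> carrier_mat n n"
  shows "N (A - C) \<le> N (A - B) + N (B - C)"
proof -
  have "A - C = (A - B) + (B - C)" using assms by (intro eq_matI) auto
  then show ?thesis using assms N_add[of "A - B" "B - C"] by (simp add: minus_carrier_mat)
qed

lemma N_star:
  assumes "A \<in> carrier_mat n n" shows "N (mat_star A) = N A"
proof -
  have *: "N A \<le> N (mat_star A)" if "A \<in> carrier_mat n n" for A
  proof (cases "N A = 0")
    case False
    have "N A * N A \<le> N (mat_star A) * N A"
      using N_cstar[OF that] N_mult[of "mat_star A" A] that by (simp add: power2_eq_square)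
    then show ?thesis using False N_nonneg[OF that] by simp
  qed (use that N_nonneg[of "mat_star A"] in simp)
  from *[OF assms] *[of "mat_star A"] assms show ?thesis by simp
qed

lemma N_one: "N (1\<^sub>m n) \<le> 1"
proof -
  have "N (1\<^sub>m n) = (N (1\<^sub>m n))\<^sup>2" using N_cstar[of "1\<^sub>m n"] by simp
  then have "N (1\<^sub>m n) * (1 - N (1\<^sub>m n)) = 0" by (simp add: algebra_simps power2_eq_square)
  then show ?thesis by auto
qed

lemma N_unitary:
  assumes "U \<in> carrier_mat n n" "mat_star U * U = 1\<^sub>m n"
  shows "N U \<le> 1"
  using N_cstar[OF assms(1)] N_one unfolding assms(2) by (simp add: power_le_one_iff N_nonneg assms(1))

lemma eq_by_limit:
  assumes "A \<in> carrier_mat n n" "B \<in> carrier_mat n n" "\<And>k::nat. N (A - B) \<le> a k" "a \<longlonglongrightarrow> 0"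
  shows "A = B"
proof -
  have "N (A - B) \<le> 0" using assms(3,4) by (intro LIMSEQ_le_const[of a]) auto
  then have "A - B = 0\<^sub>m n n"
    using N_nonneg[of "A - B"] N_eq_0[of "A - B"] assms(1,2) by (simp add: minus_carrier_mat)
  then have e: "(A - B) $$ (i, j) = 0" if "i < n" "j < n" for i j using that by simp
  show ?thesis
  proof (rule eq_matI)
    fix i j assume "i < dim_row B" "j < dim_col B"
    then show "A $$ (i, j) = B $$ (i, j)" using e[of i j] assms(1,2) by auto
  qed (use assms(1,2) in auto)
qed

text \<open>The map \<open>P \<mapsto> (X + P\<^sup>2) / 2\<close> is Lipschitz with constant \<open>\<rho>\<close> on pairs of commuting matrices of norm at
  most \<open>\<rho>\<close>, hence contracts them if \<open>\<rho> < 1\<close>.  Its fixed point \<open>L\<close> satisfies \<open>(1 - L)\<^sup>2 = 1 - X\<close>, which replaces the power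
  series of the square root.\<close>

lemma quadratic_contraction:
  assumes c: "X \<in> carrier_mat n n" "P \<in> carrier_mat n n" "Q \<in> carrier_mat n n"
    and com: "P * Q = Q * P" and b: "N P \<le> \<rho>" "N Q \<le> \<rho>"
  shows "N (mat_scaleC (1/2) (X + P * P) - mat_scaleC (1/2) (X + Q * Q)) \<le> \<rho> * N (P - Q)"
proof -
  have cc: "P * P \<in> carrier_mat n n" "Q * Q \<in> carrier_mat n n" "Q * P \<in> carrier_mat n n" using c by auto
  have "(P + Q) * (P - Q) = (P * P + Q * P) - (Q * P + Q * Q)"
    using c by (simp add: add_mult_distrib_mat[of _ n n _ _ n] mult_minus_distrib_mat[of _ n n _ n]
      minus_carrier_mat com)
  also have "\<dots> = P * P - Q * Q"
    using c cc by (intro eq_matI) (auto simp del: index_mult_mat(1))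
  finally have 1: "(P + Q) * (P - Q) = P * P - Q * Q" .
  have "mat_scaleC (1/2) (X + P * P) - mat_scaleC (1/2) (X + Q * Q)
      = mat_scaleC (1/2) ((P + Q) * (P - Q))"
    unfolding 1 using c cc
  proof (intro eq_matI, goal_cases)
    case (1 i j)
    have "(1/2) *\<^sub>C (x + p) - (1/2) *\<^sub>C (x + q) = (1/2) *\<^sub>C (p - q)" for x p q :: 'a
    proof -
      have "(1/2) *\<^sub>C z = (1/2) *\<^sub>R z" for z :: 'a using scaleC_of_real[of "1/2" z] by simp
      then show ?thesis by (simp only:) (simp add: algebra_simps)
    qed
    with 1 show ?case by (simp del: index_mult_mat(1))
  qed auto
  also have "N \<dots> = N ((P + Q) * (P - Q)) / 2" using c by (subst N_scaleC) (auto simp: minus_carrier_mat)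
  also have "\<dots> \<le> N (P + Q) * N (P - Q) / 2"
    using c by (simp add: N_mult minus_carrier_mat)
  also have "\<dots> \<le> (\<rho> + \<rho>) * N (P - Q) / 2"
    using N_add[OF c(2,3)] b c by (intro divide_right_mono mult_right_mono) (auto intro!: N_nonneg minus_carrier_mat)
  finally show ?thesis by simp
qed

text \<open>The fixed point is found by iteration from \<open>0\<close>.  All iterates are polynomials in \<open>X\<close>, so they and
  their limit commute with whatever commutes with \<open>X\<close>.\<close>

lemma quadratic_fixed_point:
  assumes X: "X \<in> carrier_mat n n" and sa: "mat_star X = X" and q: "N X < 1"
  obtains L where "L \<in> carrier_mat n n" "mat_star L = L" "L + L = X + L * L"
    "\<And>C. C \<in> carrier_mat n n \<Longrightarrow> C * X = X * C \<Longrightarrow> C * L = L * C"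
proof -
  define Y where "Y k = ((\<lambda>P. mat_scaleC (1/2) (X + P * P)) ^^ k) (0\<^sub>m n n)" for k
  have Y0: "Y 0 = 0\<^sub>m n n" and YS: "Y (Suc k) = mat_scaleC (1/2) (X + Y k * Y k)" for k
    by (auto simp: Y_def)
  have Yc [simp]: "Y k \<in> carrier_mat n n" for k using X by (induction k) (auto simp: Y0 YS)
  have YYc [simp]: "Y k * Y k \<in> carrier_mat n n" for k by (rule mult_carrier_mat[OF Yc Yc])
  have Ydim [simp]: "dim_row (Y k) = n" "dim_col (Y k) = n" for k using carrier_matD[OF Yc] by auto
  have Ysa: "mat_star (Y k) = Y k" for k
  proof (induction k)
    case (Suc k)
    have "mat_star (X + Y k * Y k) = X + Y k * Y k"
      using mat_star_add[OF X YYc] mat_star_mult[OF Yc Yc] Suc sa by simp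
    then show ?case by (simp add: YS mat_star_scaleC)
  qed (simp add: Y0)
  have Ycom: "C * Y k = Y k * C" if C: "C \<in> carrier_mat n n" and CX: "C * X = X * C" for C k
  proof (induction k)
    case 0 show ?case using C by (simp add: Y0)
  next
    case (Suc k)
    have "C * (Y k * Y k) = (Y k * Y k) * C"
      using C Yc Suc by (rule mult_square_commute)
    then have "C * (X + Y k * Y k) = (X + Y k * Y k) * C"
      using mult_add_distrib_mat[OF C X YYc]
        add_mult_distrib_mat[OF X YYc C] CX by simp
    moreover have "X + Y k * Y k \<in> carrier_mat n n"
      by (rule add_carrier_mat[OF YYc])
    ultimately show ?case
      unfolding YS by (simp only: mat_scaleC_mult(1)[OF _ C] mat_scaleC_mult(2)[OF C])
  qed
  have YX: "Y k * X = X * Y k" for k using Ycom[OF X, of k] by simp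
  have YY: "Y k * Y l = Y l * Y k" for k l using Ycom[of "Y k" l] YX by simp
  \<comment> \<open>\<open>(1 + N X) / 2\<close> bounds all iterates since \<open>N X + \<rho>\<^sup>2 \<le> 2 * \<rho>\<close>.\<close>
  define \<rho> where "\<rho> = (1 + N X) / 2"
  have q0: "N X \<ge> 0" using N_nonneg[OF X] .
  have \<rho>: "0 < \<rho>" "\<rho> < 1" using q q0 by (auto simp: \<rho>_def)
  have \<rho>q: "N X + \<rho> * \<rho> \<le> 2 * \<rho>"
  proof -
    have "2 * \<rho> - \<rho> * \<rho> - N X = (1 - N X) * (3 + N X) / 4" by (simp add: \<rho>_def field_simps)
    moreover have "(1 - N X) * (3 + N X) / 4 \<ge> 0" using q q0 by simp
    ultimately show ?thesis by linarith
  qed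
  have Yb: "N (Y k) \<le> \<rho>" for k
  proof (induction k)
    case 0 then show ?case using \<rho> N_eq_0[of "0\<^sub>m n n"] by (simp add: Y0)
  next
    case (Suc k)
    have "N (Y (Suc k)) = N (X + Y k * Y k) / 2"
      unfolding YS by (subst N_scaleC[OF add_carrier_mat[OF YYc]]) simp
    also have "N (X + Y k * Y k) \<le> N X + N (Y k) * N (Y k)"
      using X N_add[of X "Y k * Y k"] N_mult[of "Y k" "Y k"] by simp
    also have "\<dots> \<le> N X + \<rho> * \<rho>" using Suc \<rho> by (intro add_left_mono mult_mono) (auto intro: N_nonneg)
    finally show ?case using \<rho>q by simp
  qed
  have Yd: "N (Y (k + j) - Y k) \<le> \<rho> ^ k" for k j
  proof (induction k)
    case 0
    have "Y j - 0\<^sub>m n n = Y j" using Yc[of j] by (intro eq_matI) auto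
    then show ?case using Yb[of j] \<rho> by (simp add: Y0)
  next
    case (Suc k)
    have "N (Y (Suc k + j) - Y (Suc k)) \<le> \<rho> * N (Y (k + j) - Y k)"
      using quadratic_contraction[OF X Yc Yc YY Yb Yb] by (simp add: YS)
    also have "\<dots> \<le> \<rho> * \<rho> ^ k" using Suc \<rho> by (intro mult_left_mono) auto
    finally show ?case by simp
  qed
  have \<rho>0: "(\<lambda>k. \<rho> ^ k) \<longlonglongrightarrow> 0" using \<rho> by (intro LIMSEQ_realpow_zero) auto
  obtain L where L: "L \<in> carrier_mat n n" and lim: "(\<lambda>k. N (Y k - L)) \<longlonglongrightarrow> 0"
  proof (rule N_complete[of Y])
    fix e :: real assume "e > 0"
    then obtain K where K: "\<rho> ^ k < e / 2" if "k \<ge> K" for k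
      using order_tendstoD(2)[OF \<rho>0, of "e/2"] by (auto simp: eventually_sequentially)
    have "N (Y k - Y l) < e" if "k \<ge> K" "l \<ge> K" for k l
    proof -
      have "N (Y k - Y l) \<le> N (Y k - Y K) + N (Y K - Y l)" by (rule N_triangle) auto
      also have "N (Y K - Y l) = N (Y l - Y K)" by (rule N_diff_commute) auto
      also have "N (Y k - Y K) + N (Y l - Y K) \<le> \<rho> ^ K + \<rho> ^ K"
        using Yd[of K "k - K"] Yd[of K "l - K"] that by simp
      finally show ?thesis using K[of K] by simp
    qed
    then show "\<exists>K. \<forall>k\<ge>K. \<forall>l\<ge>K. N (Y k - Y l) < e" by blast
  qed auto
  have lim': "(\<lambda>k. N (Y (Suc k) - L)) \<longlonglongrightarrow> 0" using lim by (rule LIMSEQ_Suc)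
  show ?thesis
  proof
    show "L \<in> carrier_mat n n" by fact
    show "mat_star L = L"
    proof (rule eq_by_limit)
      fix k
      have "mat_star L - Y k = mat_star (L - Y k)" using L by (simp add: mat_star_minus[of _ n n] Ysa)
      then have "N (mat_star L - Y k) = N (Y k - L)"
        using L by (simp add: N_star minus_carrier_mat N_diff_commute)
      then show "N (mat_star L - L) \<le> N (Y k - L) + N (Y k - L)"
        using N_triangle[of "mat_star L" "Y k" L] L by simp
    qed (use L tendsto_add[OF lim lim] in auto)
    show "L + L = X + L * L"
    proof (rule eq_by_limit)
      fix k
      have 2: "Y (Suc k) + Y (Suc k) = X + Y k * Y k"
        unfolding YS by (rule mat_scaleC_half[OF add_carrier_mat[OF YYc]])
      have 3: "Y k * (Y k - L) = Y k * Y k - Y k * L" "(Y k - L) * L = Y k * L - L * L"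
        using L by (simp_all add: mult_minus_distrib_mat[of _ n n _ n] minus_mult_distrib_mat[of _ n n _ _ n])
      have c: "Y k * Y k \<in> carrier_mat n n" "Y k * L \<in> carrier_mat n n" "L * L \<in> carrier_mat n n"
        "Y (Suc k) \<in> carrier_mat n n" using L by auto
      have "(L + L) - (X + L * L) = ((L + L) - (Y (Suc k) + Y (Suc k))) + (X + Y k * Y k) - (X + L * L)"
        using c X L unfolding 2[symmetric] by (intro eq_matI) (auto simp del: index_mult_mat(1))
      also have "\<dots> = ((L - Y (Suc k)) + (L - Y (Suc k))) + (Y k * (Y k - L) + (Y k - L) * L)"
        using c X L unfolding 3 by (intro eq_matI) (auto simp del: index_mult_mat(1))
      also have "N \<dots> \<le> (N (L - Y (Suc k)) + N (L - Y (Suc k))) + (N (Y k) * N (Y k - L) + N (Y k - L) * N L)"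
        using L by (intro order_trans[OF N_add] add_mono N_mult) (auto simp: minus_carrier_mat)
      also have "N (L - Y (Suc k)) = N (Y (Suc k) - L)" using L by (intro N_diff_commute) auto
      also have "N (Y k) * N (Y k - L) \<le> \<rho> * N (Y k - L)"
        using Yb L by (intro mult_right_mono N_nonneg) (auto simp: minus_carrier_mat)
      finally show "N ((L + L) - (X + L * L)) \<le> (N (Y (Suc k) - L) + N (Y (Suc k) - L)) + (\<rho> * N (Y k - L) + N (Y k - L) * N L)"
        by simp
    next
      show "(\<lambda>k. (N (Y (Suc k) - L) + N (Y (Suc k) - L)) + (\<rho> * N (Y k - L) + N (Y k - L) * N L)) \<longlonglongrightarrow> 0"
        using lim lim' by (auto intro!: tendsto_eq_intros)
    qed (use X L in auto)
    fix C assume C: "C \<in> carrier_mat n n" and CX: "C * X = X * C"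
    show "C * L = L * C"
    proof (rule eq_by_limit)
      fix k
      have 3: "C * (L - Y k) = C * L - C * Y k" "(L - Y k) * C = L * C - Y k * C"
        using L C by (simp_all add: mult_minus_distrib_mat[of _ n n _ n] minus_mult_distrib_mat[of _ n n _ _ n])
      have c: "C * L \<in> carrier_mat n n" "L * C \<in> carrier_mat n n" "Y k * C \<in> carrier_mat n n" using C L by auto
      have "C * L - L * C = C * (L - Y k) - (L - Y k) * C"
        unfolding 3 Ycom[OF C CX] using c by (intro eq_matI) (auto simp del: index_mult_mat(1))
      also have "N \<dots> \<le> N C * N (L - Y k) + N (L - Y k) * N C"
        using L C by (intro order_trans[OF N_diff] add_mono N_mult) (auto simp: minus_carrier_mat)
      also have "N (L - Y k) = N (Y k - L)" using L by (intro N_diff_commute) auto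
      finally show "N (C * L - L * C) \<le> N C * N (Y k - L) + N (Y k - L) * N C" .
    next
      show "(\<lambda>k. N C * N (Y k - L) + N (Y k - L) * N C) \<longlonglongrightarrow> 0"
        using lim by (auto intro!: tendsto_eq_intros)
    qed (use C L in auto)
  qed
qed

text \<open>The unitary is \<open>H + i B\<close>, where \<open>B = 1 - L\<close> is a self-adjoint square root of \<open>1 - H\<^sup>2\<close> commuting
  with \<open>H\<close>.\<close>

lemma selfadjoint_real_part_unitary:
  assumes H: "H \<in> carrier_mat n n" and sa: "mat_star H = H" and less: "N H < 1"
  obtains U where "U \<in> carrier_mat n n" "mat_star U * U = 1\<^sub>m n" "mat_scaleC (1/2) (U + mat_star U) = H"
proof -
  have HH: "H * H \<in> carrier_mat n n" using H by auto
  have "N (H * H) \<le> N H * N H" using N_mult H by auto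
  also have "\<dots> < 1" using mult_strict_mono[of "N H" 1 "N H" 1] less N_nonneg[OF H] by simp
  finally have q: "N (H * H) < 1" .
  have HHs: "mat_star (H * H) = H * H" using H sa by (simp add: mat_star_mult[of _ n n _ n])
  obtain L where L: "L \<in> carrier_mat n n" "mat_star L = L" "L + L = H * H + L * L"
    and L': "\<And>C. C \<in> carrier_mat n n \<Longrightarrow> C * (H * H) = (H * H) * C \<Longrightarrow> C * L = L * C"
    using quadratic_fixed_point[OF HH HHs q] by blast
  have com: "H * L = L * H" using L' H mult_square_commute[OF H H refl] by blast
  define B where "B = 1\<^sub>m n - L"
  have B: "B \<in> carrier_mat n n" "mat_star B = B"
    using L by (auto simp: B_def minus_carrier_mat mat_star_minus[of _ n n])
  have HB: "H * B = B * H"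
    using H L com by (simp add: B_def mult_minus_distrib_mat[of _ n n _ n] minus_mult_distrib_mat[of _ n n _ _ n])
  have BB: "H * H + B * B = 1\<^sub>m n"
  proof -
    have c: "L * L \<in> carrier_mat n n" "L \<in> carrier_mat n n" using L by auto
    have "B * B = 1\<^sub>m n - L - (L - L * L)"
      using L by (simp add: B_def mult_minus_distrib_mat[of _ n n _ n] minus_mult_distrib_mat[of _ n n _ _ n] minus_carrier_mat)
    then have "H * H + B * B = H * H + L * L + (1\<^sub>m n - (L + L))"
      using HH c by (intro eq_matI) (auto simp del: index_mult_mat(1))
    also have "\<dots> = 1\<^sub>m n" unfolding L(3)[symmetric] using c by (intro eq_matI) auto
    finally show ?thesis .
  qed
  define U where "U = H + mat_scaleC \<i> B"
  have U: "U \<in> carrier_mat n n" using H B by (simp add: U_def)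
  have Us: "mat_star U = H - mat_scaleC \<i> B"
    unfolding U_def using H B sa
    by (subst mat_star_add[of _ n n]) (auto simp: mat_star_scaleC scaleC_minus_left)
  show ?thesis
  proof
    show "U \<in> carrier_mat n n" by fact
    have cc: "H * H \<in> carrier_mat n n" "B * B \<in> carrier_mat n n" "B * H \<in> carrier_mat n n" using H B by auto
    have "mat_star U * U = (H * H + mat_scaleC \<i> (B * H)) - (mat_scaleC \<i> (B * H) + mat_scaleC (\<i> * \<i>) (B * B))"
      unfolding Us unfolding U_def using H B HB
      by (subst minus_mult_distrib_mat[of _ n n _ _ n])
         (auto simp: mult_add_distrib_mat[of _ n n _ n] mat_scaleC_mult[of _ n n _ n])
    also have "\<dots> = H * H + B * B"
      using cc H B by (intro eq_matI) (auto simp: scaleC_minus_left simp del: index_mult_mat(1))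
    finally show "mat_star U * U = 1\<^sub>m n" using BB by simp
    show "mat_scaleC (1/2) (U + mat_star U) = H"
      unfolding Us unfolding U_def using H B
      by (intro eq_matI) (auto simp: scaleC_add_left[symmetric] scaleC_add_right)
  qed
qed

end

lemma N_dsum_selfadjoint:
  assumes nm: "n \<ge> 1" "m \<ge> 1"
    and H: "H \<in> carrier_mat n n" "mat_star H = H" "N H < 1"
    and K: "K \<in> carrier_mat m m" "mat_star K = K" "N K < 1"
  shows "N (H \<oplus>\<^sub>d K) \<le> 1"
proof -
  obtain U where U: "U \<in> carrier_mat n n" "mat_star U * U = 1\<^sub>m n" "mat_scaleC (1/2) (U + mat_star U) = H"
    using selfadjoint_real_part_unitary[OF nm(1) H] .
  obtain V where V: "V \<in> carrier_mat m m" "mat_star V * V = 1\<^sub>m m" "mat_scaleC (1/2) (V + mat_star V) = K"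
    using selfadjoint_real_part_unitary[OF nm(2) K] .
  define W where "W = U \<oplus>\<^sub>d V"
  have nm': "n + m \<ge> 1" using nm by simp
  have W: "W \<in> carrier_mat (n + m) (n + m)" using U V by (simp add: W_def)
  have "mat_star W * W = 1\<^sub>m n \<oplus>\<^sub>d 1\<^sub>m m"
    using U V by (simp add: W_def mat_star_dsum mult_dsum[of _ n _ _ m])
  also have "\<dots> = 1\<^sub>m (n + m)" by (simp add: dsum_def)
  finally have NW: "N W \<le> 1" using N_unitary[OF nm' W] by simp
  have "H \<oplus>\<^sub>d K = mat_scaleC (1/2) (W + mat_star W)"
    unfolding U(3)[symmetric] V(3)[symmetric] W_def mat_star_dsum
    using U(1) V(1) by (intro eq_matI) (auto simp: dsum_def)
  also have "N \<dots> = N (W + mat_star W) / 2" using W by (simp add: N_scaleC[OF nm'])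
  also have "\<dots> \<le> 1" using N_add[OF nm' W, of "mat_star W"] N_star[OF nm' W] NW W by simp
  finally show ?thesis .
qed

text \<open>The general case follows from the self-adjoint one by the C*-identity, applied to
  \<open>X\<^sup>* X / M\<^sup>2\<close> and \<open>Y\<^sup>* Y / M\<^sup>2\<close> for any \<open>M\<close> above both norms.\<close>

lemma N_dsum:
  assumes nm: "n \<ge> 1" "m \<ge> 1" and X: "X \<in> carrier_mat n n" and Y: "Y \<in> carrier_mat m m"
  shows "N (X \<oplus>\<^sub>d Y) \<le> max (N X) (N Y)"
proof (rule dense_ge)
  fix M assume M: "max (N X) (N Y) < M"
  have nm': "n + m \<ge> 1" using nm by simp
  have M0: "M > 0" using M N_nonneg[OF nm(1) X] by simp
  define c where "c = complex_of_real (1 / M\<^sup>2)"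
  have c: "cnj c = c" "cmod c = 1 / M\<^sup>2" by (simp_all add: c_def norm_divide norm_power)
  have *: "N (mat_scaleC c (mat_star A * A)) < 1 \<and> mat_star (mat_scaleC c (mat_star A * A)) = mat_scaleC c (mat_star A * A)"
    if A: "k \<ge> 1" "A \<in> carrier_mat k k" "N A < M" for k A
  proof -
    have "N (mat_scaleC c (mat_star A * A)) = (N A)\<^sup>2 / M\<^sup>2"
      using A by (simp add: N_scaleC[OF A(1)] N_cstar[OF A(1)] c)
    also have "\<dots> < 1" using A M0 N_nonneg[OF A(1,2)] by (simp add: power_strict_mono)
    finally show ?thesis using A by (simp add: mat_star_scaleC mat_star_mult[of _ k k _ k] c)
  qed
  have XY: "X \<oplus>\<^sub>d Y \<in> carrier_mat (n + m) (n + m)" using X Y by simp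
  have "mat_scaleC c (mat_star X * X) \<oplus>\<^sub>d mat_scaleC c (mat_star Y * Y)
      = mat_scaleC c (mat_star (X \<oplus>\<^sub>d Y) * (X \<oplus>\<^sub>d Y))"
    using X Y unfolding mat_star_dsum
    by (subst mult_dsum[of _ n _ _ m]) (auto simp: dsum_def simp del: index_mult_mat(1) intro!: eq_matI)
  then have "N (mat_scaleC c (mat_star (X \<oplus>\<^sub>d Y) * (X \<oplus>\<^sub>d Y))) \<le> 1"
    using N_dsum_selfadjoint[OF nm, of "mat_scaleC c (mat_star X * X)" "mat_scaleC c (mat_star Y * Y)"]
      *[OF nm(1) X] *[OF nm(2) Y] M X Y by simp
  then have "(N (X \<oplus>\<^sub>d Y))\<^sup>2 / M\<^sup>2 \<le> 1"
    using XY by (simp add: N_scaleC[OF nm'] N_cstar[OF nm'] c)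
  then have "(N (X \<oplus>\<^sub>d Y))\<^sup>2 \<le> M\<^sup>2" using M0 by simp
  then show "N (X \<oplus>\<^sub>d Y) \<le> M" by (rule power2_le_imp_le) (use M0 in simp)
qed

end

section \<open>Coordinate inclusions and projections\<close>

text \<open>The inclusions \<open>[1; 0]\<close>, \<open>[0; 1]\<close> of the summands of sizes \<open>n\<close> and \<open>m\<close> into size \<open>n + m\<close>, and
  the projections \<open>[1, 0]\<close>, \<open>[0, 1]\<close>.  The entry type is left open so that the same symbols denote
  scalar matrices and their amplifications.\<close>

definition incl1 :: "nat \<Rightarrow> nat \<Rightarrow> 'b::{zero,one} mat" where
  "incl1 n m = mat (n + m) n (\<lambda>(i, j). if i = j then 1 else 0)"

definition incl2 :: "nat \<Rightarrow> nat \<Rightarrow> 'b::{zero,one} mat" where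
  "incl2 n m = mat (n + m) m (\<lambda>(i, j). if i = n + j then 1 else 0)"

definition proj1 :: "nat \<Rightarrow> nat \<Rightarrow> 'b::{zero,one} mat" where
  "proj1 n m = mat n (n + m) (\<lambda>(i, j). if j = i then 1 else 0)"

definition proj2 :: "nat \<Rightarrow> nat \<Rightarrow> 'b::{zero,one} mat" where
  "proj2 n m = mat m (n + m) (\<lambda>(i, j). if j = n + i then 1 else 0)"

lemma incl_proj_carrier [simp]:
  "incl1 n m \<in> carrier_mat (n + m) n" "incl2 n m \<in> carrier_mat (n + m) m"
  "proj1 n m \<in> carrier_mat n (n + m)" "proj2 n m \<in> carrier_mat m (n + m)"
  by (simp_all add: incl1_def incl2_def proj1_def proj2_def)

lemma dim_incl_proj [simp]:
  "dim_row (incl1 n m) = n + m" "dim_col (incl1 n m) = n" "dim_row (incl2 n m) = n + m" "dim_col (incl2 n m) = m"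
  "dim_row (proj1 n m) = n" "dim_col (proj1 n m) = n + m" "dim_row (proj2 n m) = m" "dim_col (proj2 n m) = n + m"
  by (simp_all add: incl1_def incl2_def proj1_def proj2_def)

lemma amp_incl_proj [simp]:
  "amp (incl1 n m) 1 = (incl1 n m :: 'a::unital_cstar_algebra mat)"
  "amp (incl2 n m) 1 = (incl2 n m :: 'a::unital_cstar_algebra mat)"
  "amp (proj1 n m) 1 = (proj1 n m :: 'a::unital_cstar_algebra mat)"
  "amp (proj2 n m) 1 = (proj2 n m :: 'a::unital_cstar_algebra mat)"
  by (auto intro!: eq_matI simp: incl1_def incl2_def proj1_def proj2_def)

lemma sum_mult_indicator:
  fixes h :: "nat \<Rightarrow> 'b::semiring_1"
  shows "(\<Sum>k\<in>{0..<K}. h k * (if k = c then 1 else 0)) = (if c < K then h c else 0)"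
    "(\<Sum>k\<in>{0..<K}. (if k = c then 1 else 0) * h k) = (if c < K then h c else 0)"
    "(\<Sum>k\<in>{0..<K}. h k * (if c = k then 1 else 0)) = (if c < K then h c else 0)"
    "(\<Sum>k\<in>{0..<K}. (if c = k then 1 else 0) * h k) = (if c < K then h c else 0)"
  by (simp_all add: if_distrib[of "\<lambda>x. h _ * x"] if_distrib[of "\<lambda>x. x * h _"] cong: if_cong)

lemma sum_mult_indicator_shift:
  fixes h :: "nat \<Rightarrow> 'b::semiring_1"
  shows "(\<Sum>k\<in>{0..<K}. h k * (if c = n + k then 1 else 0)) = (if n \<le> c \<and> c < n + K then h (c - n) else 0)"
    "(\<Sum>k\<in>{0..<K}. (if c = n + k then 1 else 0) * h k) = (if n \<le> c \<and> c < n + K then h (c - n) else 0)"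
proof -
  have "(c = n + k) = (n \<le> c \<and> k = c - n)" for k by auto
  then show "(\<Sum>k\<in>{0..<K}. h k * (if c = n + k then 1 else 0)) = (if n \<le> c \<and> c < n + K then h (c - n) else 0)"
    "(\<Sum>k\<in>{0..<K}. (if c = n + k then 1 else 0) * h k) = (if n \<le> c \<and> c < n + K then h (c - n) else 0)"
    by (cases "n \<le> c"; simp add: sum_mult_indicator; auto)+
qed

lemma index_mult_incl_proj:
  fixes A :: "'b::semiring_1 mat"
  shows
  "A \<in> carrier_mat p (n + m) \<Longrightarrow> i < p \<Longrightarrow> j < n \<Longrightarrow> (A * incl1 n m) $$ (i, j) = A $$ (i, j)"
  "A \<in> carrier_mat p (n + m) \<Longrightarrow> i < p \<Longrightarrow> j < m \<Longrightarrow> (A * incl2 n m) $$ (i, j) = A $$ (i, n + j)"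
  "A \<in> carrier_mat (n + m) p \<Longrightarrow> i < n \<Longrightarrow> j < p \<Longrightarrow> (proj1 n m * A) $$ (i, j) = A $$ (i, j)"
  "A \<in> carrier_mat (n + m) p \<Longrightarrow> i < m \<Longrightarrow> j < p \<Longrightarrow> (proj2 n m * A) $$ (i, j) = A $$ (n + i, j)"
  "A \<in> carrier_mat n p \<Longrightarrow> i < n + m \<Longrightarrow> j < p \<Longrightarrow> (incl1 n m * A) $$ (i, j) = (if i < n then A $$ (i, j) else 0)"
  "A \<in> carrier_mat m p \<Longrightarrow> i < n + m \<Longrightarrow> j < p \<Longrightarrow> (incl2 n m * A) $$ (i, j) = (if i < n then 0 else A $$ (i - n, j))"
  "A \<in> carrier_mat p n \<Longrightarrow> i < p \<Longrightarrow> j < n + m \<Longrightarrow> (A * proj1 n m) $$ (i, j) = (if j < n then A $$ (i, j) else 0)"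
  "A \<in> carrier_mat p m \<Longrightarrow> i < p \<Longrightarrow> j < n + m \<Longrightarrow> (A * proj2 n m) $$ (i, j) = (if j < n then 0 else A $$ (i, j - n))"
  by (simp_all add: scalar_prod_def incl1_def incl2_def proj1_def proj2_def sum_mult_indicator
      sum_mult_indicator_shift)

lemma upper_tri_intertwines:
  fixes X Y Z :: "'b::semiring_1 mat"
  assumes "X \<in> carrier_mat n n" "Y \<in> carrier_mat m m" "Z \<in> carrier_mat n m"
  shows "upper_tri X Z Y * incl1 n m = incl1 n m * X"
    and "Y * proj2 n m = proj2 n m * upper_tri X Z Y"
proof -
  have T: "upper_tri X Z Y \<in> carrier_mat (n + m) (n + m)" using assms by simp
  note c = T mult_carrier_mat[OF T incl_proj_carrier(1)] mult_carrier_mat[OF incl_proj_carrier(1) assms(1)]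
    mult_carrier_mat[OF assms(2) incl_proj_carrier(4)] mult_carrier_mat[OF incl_proj_carrier(4) T]
  show "upper_tri X Z Y * incl1 n m = incl1 n m * X"
  proof (rule eq_matI)
    fix i j assume "i < dim_row (incl1 n m * X)" "j < dim_col (incl1 n m * X)"
    then have ij: "i < n + m" "j < n" using c assms by auto
    show "(upper_tri X Z Y * incl1 n m) $$ (i, j) = (incl1 n m * X) $$ (i, j)"
      unfolding index_mult_incl_proj(1)[OF c(1) ij] index_mult_incl_proj(5)[OF assms(1) ij]
      using assms ij by (auto simp: upper_tri_def)
  qed (use c assms in auto)
  show "Y * proj2 n m = proj2 n m * upper_tri X Z Y"
  proof (rule eq_matI)
    fix i j assume "i < dim_row (proj2 n m * upper_tri X Z Y)" "j < dim_col (proj2 n m * upper_tri X Z Y)"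
    then have ij: "i < m" "j < n + m" using c assms by auto
    show "(Y * proj2 n m) $$ (i, j) = (proj2 n m * upper_tri X Z Y) $$ (i, j)"
      unfolding index_mult_incl_proj(4)[OF c(1) ij] index_mult_incl_proj(8)[OF assms(2) ij]
      using assms ij by (auto simp: upper_tri_def)
  qed (use c assms in auto)
qed

lemma dsum_intertwines:
  fixes X Y :: "'b::semiring_1 mat"
  assumes "X \<in> carrier_mat n n" "Y \<in> carrier_mat m m"
  shows "(X \<oplus>\<^sub>d Y) * incl1 n m = incl1 n m * X" "(X \<oplus>\<^sub>d Y) * incl2 n m = incl2 n m * Y"
    "X * proj1 n m = proj1 n m * (X \<oplus>\<^sub>d Y)" "Y * proj2 n m = proj2 n m * (X \<oplus>\<^sub>d Y)"
proof -
  show "(X \<oplus>\<^sub>d Y) * incl1 n m = incl1 n m * X" "Y * proj2 n m = proj2 n m * (X \<oplus>\<^sub>d Y)"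
    unfolding dsum_eq_upper_tri[OF assms] by (intro upper_tri_intertwines[OF assms] zero_carrier_mat)+
  have T: "X \<oplus>\<^sub>d Y \<in> carrier_mat (n + m) (n + m)" using assms by simp
  note c = T mult_carrier_mat[OF T incl_proj_carrier(2)] mult_carrier_mat[OF incl_proj_carrier(2) assms(2)]
    mult_carrier_mat[OF assms(1) incl_proj_carrier(3)] mult_carrier_mat[OF incl_proj_carrier(3) T]
  show "(X \<oplus>\<^sub>d Y) * incl2 n m = incl2 n m * Y"
  proof (rule eq_matI)
    fix i j assume "i < dim_row (incl2 n m * Y)" "j < dim_col (incl2 n m * Y)"
    then have ij: "i < n + m" "j < m" using c assms by auto
    show "((X \<oplus>\<^sub>d Y) * incl2 n m) $$ (i, j) = (incl2 n m * Y) $$ (i, j)"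
      unfolding index_mult_incl_proj(2)[OF c(1) ij] index_mult_incl_proj(6)[OF assms(2) ij]
      using assms ij by (auto simp: dsum_def)
  qed (use c assms in auto)
  show "X * proj1 n m = proj1 n m * (X \<oplus>\<^sub>d Y)"
  proof (rule eq_matI)
    fix i j assume "i < dim_row (proj1 n m * (X \<oplus>\<^sub>d Y))" "j < dim_col (proj1 n m * (X \<oplus>\<^sub>d Y))"
    then have ij: "i < n" "j < n + m" using c assms by auto
    show "(X * proj1 n m) $$ (i, j) = (proj1 n m * (X \<oplus>\<^sub>d Y)) $$ (i, j)"
      unfolding index_mult_incl_proj(3)[OF c(1) ij] index_mult_incl_proj(7)[OF assms(1) ij]
      using assms ij by (auto simp: dsum_def)
  qed (use c assms in auto)
qed

lemma upper_tri_mult_diag: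
  fixes A B C :: "'b::semiring_0 mat"
  assumes "A \<in> carrier_mat n n" "B \<in> carrier_mat n m" "C \<in> carrier_mat m m"
    "S \<in> carrier_mat n n'" "R \<in> carrier_mat m m'"
  shows "upper_tri A B C * four_block_mat S (0\<^sub>m n m') (0\<^sub>m m n') R
    = four_block_mat (A * S) (B * R) (0\<^sub>m m n') (C * R)"
  unfolding upper_tri_def using assms
  by (subst mult_four_block_mat[of _ n n _ m _ m _ _ n' _ m']) auto

lemma diag_mult_upper_tri:
  fixes A B C :: "'b::semiring_0 mat"
  assumes "A \<in> carrier_mat n' n'" "B \<in> carrier_mat n' m'" "C \<in> carrier_mat m' m'"
    "S \<in> carrier_mat n n'" "R \<in> carrier_mat m m'"
  shows "four_block_mat S (0\<^sub>m n m') (0\<^sub>m m n') R * upper_tri A B C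
    = four_block_mat (S * A) (S * B) (0\<^sub>m m n') (R * C)"
  unfolding upper_tri_def using assms
  by (subst mult_four_block_mat[of _ n n' _ m' _ m _ _ n' _ m']) auto

lemma upper_right_carrier [simp]:
  "upper_right n m W \<in> carrier_mat n m" "dim_row (upper_right n m W) = n" "dim_col (upper_right n m W) = m"
  by (simp_all add: upper_right_def)

section \<open>The tensor coefficients\<close>

lemma sum_split_add: "(\<Sum>b<p + q. g b) = (\<Sum>b<p. g b) + (\<Sum>b<q. g (p + b))"
  for g :: "nat \<Rightarrow> 'b::comm_monoid_add"
  by (induction q) (auto simp: add.assoc)

text \<open>Sums over the rows of a tensor, arranged by the pair of indices in the two legs.\<close>

lemma sum_tensor_index: "(\<Sum>k<n * m. g k) = (\<Sum>a<n. \<Sum>c<m. g (a * m + c))"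
  for g :: "nat \<Rightarrow> 'b::comm_monoid_add"
proof (induction n)
  case (Suc n)
  have "(\<Sum>k<Suc n * m. g k) = (\<Sum>k<n * m + m. g k)" by (simp add: add.commute)
  then show ?case using Suc by (simp add: sum_split_add)
qed simp

lemma tensor_eqI:
  assumes S: "S \<in> carrier_mat (n * m) (n * m)" and T: "T \<in> carrier_mat (n * m) (n * m)"
    and eq: "\<And>a b c d. a < n \<Longrightarrow> b < n \<Longrightarrow> c < m \<Longrightarrow> d < m \<Longrightarrow> tcoeff m S a b c d = tcoeff m T a b c d"
  shows "S = T"
proof (rule eq_matI)
  fix i j assume "i < dim_row T" "j < dim_col T"
  then have ij: "i < n * m" "j < n * m" using T by auto
  then have "m > 0" by (cases m) auto
  then have "tcoeff m S (i div m) (j div m) (i mod m) (j mod m) = tcoeff m T (i div m) (j div m) (i mod m) (j mod m)"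
    using ij by (intro eq) (auto simp: less_mult_imp_div_less)
  then show "S $$ (i, j) = T $$ (i, j)" by (simp add: tcoeff_def)
qed (use S T in auto)

lemma tcoeff_mult:
  assumes "S \<in> carrier_mat (n * m) (n * m)" "T \<in> carrier_mat (n * m) (n * m)"
    "a < n" "b < n" "c < m" "d < m"
  shows "tcoeff m (S * T) a b c d = (\<Sum>k<n. \<Sum>l<m. tcoeff m S a k c l * tcoeff m T k b l d)"
  using assms tensor_index_less[of a n c m] tensor_index_less[of b n d m]
  by (simp add: tcoeff_def scalar_prod_def lessThan_atLeast0[symmetric] sum_tensor_index tensor_index_less)

lemma tcoeff_kron:
  assumes "A \<in> carrier_mat n n" "C \<in> carrier_mat m m" "a < n" "b < n" "c < m" "d < m"
  shows "tcoeff m (kron A C) a b c d = A $$ (a, b) * C $$ (c, d)"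
  using assms by (simp add: kron_def tcoeff_tmat)

lemma kron_carrier [simp]:
  "A \<in> carrier_mat n n \<Longrightarrow> C \<in> carrier_mat m m \<Longrightarrow> kron A C \<in> carrier_mat (n * m) (n * m)"
  by (auto simp: kron_def)

lemma unit_mat_carrier [simp]: "unit_mat n m b c \<in> carrier_mat n m"
  by (simp add: unit_mat_def)

lemma hash_index: "a < n \<Longrightarrow> d < m \<Longrightarrow> hash n m T \<gamma> $$ (a, d) = (\<Sum>b<n. \<Sum>c<m. tcoeff m T a b c d * \<gamma> $$ (b, c))"
  by (simp add: hash_def)

lemma hash_unit_mat:
  assumes "a < n" "b < n" "c < m" "d < m"
  shows "hash n m T (unit_mat n m b c) $$ (a, d) = tcoeff m T a b c d"
proof -
  have "hash n m T (unit_mat n m b c) $$ (a, d) = (\<Sum>k<n. \<Sum>l<m. if k = b then if l = c then tcoeff m T a b c d else 0 else 0)"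
    using assms unfolding hash_index[OF assms(1,4)] by (intro sum.cong refl) (auto simp: unit_mat_def)
  also have "\<dots> = (\<Sum>k<n. if k = b then tcoeff m T a b c d else 0)"
    using assms by (intro sum.cong refl) auto
  finally show ?thesis using assms by simp
qed

text \<open>An element of the tensor product is determined by its action, since the matrix units recover its
  coefficients.\<close>

lemma hash_inject:
  assumes "S \<in> carrier_mat (n * m) (n * m)" "T \<in> carrier_mat (n * m) (n * m)"
    and "\<And>\<gamma>. \<gamma> \<in> carrier_mat n m \<Longrightarrow> hash n m S \<gamma> = hash n m T \<gamma>"
  shows "S = T"
  using assms(1,2)
proof (rule tensor_eqI)
  fix a b c d assume "a < n" "b < n" "c < m" "d < m"
  then show "tcoeff m S a b c d = tcoeff m T a b c d"
    using assms(3)[of "unit_mat n m b c"] hash_unit_mat[of a n b c m d] by (metis unit_mat_carrier)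
qed

text \<open>Multiplication of a tensor by an elementary tensor with one trivial leg acts on \<open>hash\<close> through
  \<open>(A \<otimes> C) # \<gamma> = A \<gamma> C\<close>: left multiplication in the first leg and right multiplication in the second
  act on the value, the other two act on \<open>\<gamma>\<close>.\<close>

lemma hash_kron_legs:
  assumes T: "T \<in> carrier_mat (n * m) (n * m)" and g: "\<gamma> \<in> carrier_mat n m"
  shows "s \<in> carrier_mat n n \<Longrightarrow> hash n m (kron s (1\<^sub>m m) * T) \<gamma> = s * hash n m T \<gamma>"
    and "t \<in> carrier_mat n n \<Longrightarrow> hash n m (T * kron t (1\<^sub>m m)) \<gamma> = hash n m T (t * \<gamma>)"
    and "u \<in> carrier_mat m m \<Longrightarrow> hash n m (kron (1\<^sub>m n) u * T) \<gamma> = hash n m T (\<gamma> * u)"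
    and "v \<in> carrier_mat m m \<Longrightarrow> hash n m (T * kron (1\<^sub>m n) v) \<gamma> = hash n m T \<gamma> * v"
proof -
  have delta: "(\<Sum>l<K. x l * ((if l = c then 1 else 0) * y l)) = (if c < K then x c * y c else 0)"
    "(\<Sum>l<K. x l * ((if c = l then 1 else 0) * y l)) = (if c < K then x c * y c else 0)"
    for x y :: "nat \<Rightarrow> complex" and c K
    by (simp_all add: if_distrib[of "\<lambda>z. x _ * (z * y _)"] cong: if_cong)
  {
    assume s: "s \<in> carrier_mat n n"
    have co: "tcoeff m (kron s (1\<^sub>m m) * T) a b c d = (\<Sum>k<n. s $$ (a, k) * tcoeff m T k b c d)"
      if "a < n" "b < n" "c < m" "d < m" for a b c d
    proof -
      have "tcoeff m (kron s (1\<^sub>m m) * T) a b c d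
        = (\<Sum>k<n. \<Sum>l<m. s $$ (a, k) * ((if c = l then 1 else 0) * tcoeff m T k b l d))"
        unfolding tcoeff_mult[OF kron_carrier[OF s one_carrier_mat] T that] using that s
        by (intro sum.cong refl) (simp add: tcoeff_kron[of _ n])
      then show ?thesis using that by (simp add: delta)
    qed
    show "hash n m (kron s (1\<^sub>m m) * T) \<gamma> = s * hash n m T \<gamma>"
    proof (rule eq_matI)
      fix a d assume "a < dim_row (s * hash n m T \<gamma>)" "d < dim_col (s * hash n m T \<gamma>)"
      then have ad: "a < n" "d < m" using s by (auto simp: hash_def)
      have "hash n m (kron s (1\<^sub>m m) * T) \<gamma> $$ (a, d)
        = (\<Sum>b<n. \<Sum>c<m. \<Sum>k<n. s $$ (a, k) * (tcoeff m T k b c d * \<gamma> $$ (b, c)))"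
        unfolding hash_index[OF ad] using ad by (intro sum.cong refl) (simp add: co sum_distrib_right mult.assoc)
      also have "\<dots> = (\<Sum>b<n. \<Sum>k<n. \<Sum>c<m. s $$ (a, k) * (tcoeff m T k b c d * \<gamma> $$ (b, c)))"
        by (intro sum.cong refl sum.swap)
      also have "\<dots> = (\<Sum>k<n. \<Sum>b<n. \<Sum>c<m. s $$ (a, k) * (tcoeff m T k b c d * \<gamma> $$ (b, c)))"
        by (rule sum.swap)
      also have "\<dots> = (s * hash n m T \<gamma>) $$ (a, d)"
        using ad s by (simp add: scalar_prod_def lessThan_atLeast0[symmetric] hash_index sum_distrib_left hash_def[THEN arg_cong, of dim_row] hash_def[THEN arg_cong, of dim_col])
      finally show "hash n m (kron s (1\<^sub>m m) * T) \<gamma> $$ (a, d) = (s * hash n m T \<gamma>) $$ (a, d)" .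
    qed (use s in \<open>auto simp: hash_def\<close>)
  }
  {
    assume t: "t \<in> carrier_mat n n"
    have co: "tcoeff m (T * kron t (1\<^sub>m m)) a b c d = (\<Sum>k<n. tcoeff m T a k c d * t $$ (k, b))"
      if "a < n" "b < n" "c < m" "d < m" for a b c d
    proof -
      have "tcoeff m (T * kron t (1\<^sub>m m)) a b c d
        = (\<Sum>k<n. \<Sum>l<m. tcoeff m T a k c l * ((if l = d then 1 else 0) * t $$ (k, b)))"
        unfolding tcoeff_mult[OF T kron_carrier[OF t one_carrier_mat] that] using that t
        by (intro sum.cong refl) (simp add: tcoeff_kron[of _ n])
      then show ?thesis using that by (simp add: delta)
    qed
    show "hash n m (T * kron t (1\<^sub>m m)) \<gamma> = hash n m T (t * \<gamma>)"
    proof (rule eq_matI)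
      fix a d assume "a < dim_row (hash n m T (t * \<gamma>))" "d < dim_col (hash n m T (t * \<gamma>))"
      then have ad: "a < n" "d < m" by (auto simp: hash_def)
      have "hash n m (T * kron t (1\<^sub>m m)) \<gamma> $$ (a, d)
        = (\<Sum>b<n. \<Sum>c<m. \<Sum>k<n. tcoeff m T a k c d * (t $$ (k, b) * \<gamma> $$ (b, c)))"
        unfolding hash_index[OF ad] using ad by (intro sum.cong refl) (simp add: co sum_distrib_right mult.assoc)
      also have "\<dots> = (\<Sum>b<n. \<Sum>k<n. \<Sum>c<m. tcoeff m T a k c d * (t $$ (k, b) * \<gamma> $$ (b, c)))"
        by (intro sum.cong refl sum.swap)
      also have "\<dots> = (\<Sum>k<n. \<Sum>b<n. \<Sum>c<m. tcoeff m T a k c d * (t $$ (k, b) * \<gamma> $$ (b, c)))"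
        by (rule sum.swap)
      also have "\<dots> = (\<Sum>k<n. \<Sum>c<m. \<Sum>b<n. tcoeff m T a k c d * (t $$ (k, b) * \<gamma> $$ (b, c)))"
        by (intro sum.cong refl sum.swap)
      also have "\<dots> = hash n m T (t * \<gamma>) $$ (a, d)"
        using ad t g by (simp add: scalar_prod_def lessThan_atLeast0[symmetric] hash_index sum_distrib_left)
      finally show "hash n m (T * kron t (1\<^sub>m m)) \<gamma> $$ (a, d) = hash n m T (t * \<gamma>) $$ (a, d)" .
    qed (auto simp: hash_def)
  }
  {
    assume u: "u \<in> carrier_mat m m"
    have co: "tcoeff m (kron (1\<^sub>m n) u * T) a b c d = (\<Sum>l<m. u $$ (c, l) * tcoeff m T a b l d)"
      if "a < n" "b < n" "c < m" "d < m" for a b c d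
    proof -
      have "tcoeff m (kron (1\<^sub>m n) u * T) a b c d = (\<Sum>k<n. \<Sum>l<m. (if a = k then 1 else 0) * (u $$ (c, l) * tcoeff m T k b l d))"
        unfolding tcoeff_mult[OF kron_carrier[OF one_carrier_mat u] T that] using that u
        by (intro sum.cong refl) (simp add: tcoeff_kron[of _ n])
      also have "\<dots> = (\<Sum>k<n. if a = k then (\<Sum>l<m. u $$ (c, l) * tcoeff m T k b l d) else 0)"
        by (intro sum.cong refl) auto
      finally show ?thesis using that by simp
    qed
    show "hash n m (kron (1\<^sub>m n) u * T) \<gamma> = hash n m T (\<gamma> * u)"
    proof (rule eq_matI)
      fix a d assume "a < dim_row (hash n m T (\<gamma> * u))" "d < dim_col (hash n m T (\<gamma> * u))"
      then have ad: "a < n" "d < m" by (auto simp: hash_def)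
      have "hash n m (kron (1\<^sub>m n) u * T) \<gamma> $$ (a, d)
        = (\<Sum>b<n. \<Sum>c<m. \<Sum>l<m. tcoeff m T a b l d * (\<gamma> $$ (b, c) * u $$ (c, l)))"
        unfolding hash_index[OF ad] using ad by (intro sum.cong refl) (simp add: co sum_distrib_left sum_distrib_right mult_ac)
      also have "\<dots> = (\<Sum>b<n. \<Sum>l<m. \<Sum>c<m. tcoeff m T a b l d * (\<gamma> $$ (b, c) * u $$ (c, l)))"
        by (intro sum.cong refl sum.swap)
      also have "\<dots> = hash n m T (\<gamma> * u) $$ (a, d)"
        using ad u g by (simp add: scalar_prod_def lessThan_atLeast0[symmetric] hash_index sum_distrib_left)
      finally show "hash n m (kron (1\<^sub>m n) u * T) \<gamma> $$ (a, d) = hash n m T (\<gamma> * u) $$ (a, d)" .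
    qed (auto simp: hash_def)
  }
  {
    assume v: "v \<in> carrier_mat m m"
    have co: "tcoeff m (T * kron (1\<^sub>m n) v) a b c d = (\<Sum>l<m. tcoeff m T a b c l * v $$ (l, d))"
      if "a < n" "b < n" "c < m" "d < m" for a b c d
    proof -
      have "tcoeff m (T * kron (1\<^sub>m n) v) a b c d = (\<Sum>k<n. \<Sum>l<m. (if k = b then 1 else 0) * (tcoeff m T a k c l * v $$ (l, d)))"
        unfolding tcoeff_mult[OF T kron_carrier[OF one_carrier_mat v] that] using that v
        by (intro sum.cong refl) (simp add: tcoeff_kron[of _ n])
      also have "\<dots> = (\<Sum>k<n. if k = b then (\<Sum>l<m. tcoeff m T a k c l * v $$ (l, d)) else 0)"
        by (intro sum.cong refl) auto
      finally show ?thesis using that by simp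
    qed
    show "hash n m (T * kron (1\<^sub>m n) v) \<gamma> = hash n m T \<gamma> * v"
    proof (rule eq_matI)
      fix a d assume "a < dim_row (hash n m T \<gamma> * v)" "d < dim_col (hash n m T \<gamma> * v)"
      then have ad: "a < n" "d < m" using v by (auto simp: hash_def)
      have "hash n m (T * kron (1\<^sub>m n) v) \<gamma> $$ (a, d)
        = (\<Sum>b<n. \<Sum>c<m. \<Sum>l<m. tcoeff m T a b c l * \<gamma> $$ (b, c) * v $$ (l, d))"
        unfolding hash_index[OF ad] using ad by (intro sum.cong refl) (simp add: co sum_distrib_left sum_distrib_right mult_ac)
      also have "\<dots> = (\<Sum>b<n. \<Sum>l<m. \<Sum>c<m. tcoeff m T a b c l * \<gamma> $$ (b, c) * v $$ (l, d))"
        by (intro sum.cong refl sum.swap)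
      also have "\<dots> = (\<Sum>l<m. \<Sum>b<n. \<Sum>c<m. tcoeff m T a b c l * \<gamma> $$ (b, c) * v $$ (l, d))"
        by (rule sum.swap)
      also have "\<dots> = (hash n m T \<gamma> * v) $$ (a, d)"
        using ad v by (simp add: scalar_prod_def lessThan_atLeast0[symmetric] hash_index sum_distrib_right hash_def[THEN arg_cong, of dim_row] hash_def[THEN arg_cong, of dim_col])
      finally show "hash n m (T * kron (1\<^sub>m n) v) \<gamma> $$ (a, d) = (hash n m T \<gamma> * v) $$ (a, d)" .
    qed (use v in \<open>auto simp: hash_def\<close>)
  }
qed

lemma hash_dsum_left:
  assumes "S \<in> carrier_mat (p * m) (p * m)" "T \<in> carrier_mat (q * m) (q * m)" "\<gamma> \<in> carrier_mat (p + q) m"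
    "a < p + q" "d < m"
  shows "hash (p + q) m (dsum_left p q m S T) \<gamma> $$ (a, d)
    = (if a < p then hash p m S (proj1 p q * \<gamma>) $$ (a, d) else hash q m T (proj2 p q * \<gamma>) $$ (a - p, d))"
proof -
  have "hash (p + q) m (dsum_left p q m S T) \<gamma> $$ (a, d) =
    (\<Sum>b<p. \<Sum>c<m. (if a < p then tcoeff m S a b c d else 0) * \<gamma> $$ (b, c))
     + (\<Sum>b<q. \<Sum>c<m. (if a < p then 0 else tcoeff m T (a - p) b c d) * \<gamma> $$ (p + b, c))"
    unfolding hash_index[OF assms(4,5)] sum_split_add using assms(4,5)
    by (intro arg_cong2[of _ _ _ _ "(+)"] sum.cong refl) (simp_all add: dsum_left_def tcoeff_tmat)
  also have "\<dots> = (if a < p then hash p m S (proj1 p q * \<gamma>) $$ (a, d) else hash q m T (proj2 p q * \<gamma>) $$ (a - p, d))"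
    using assms by (auto simp: hash_index index_mult_incl_proj(3,4)[OF assms(3)] simp del: index_mult_mat(1) intro!: sum.cong)
  finally show ?thesis .
qed

lemma hash_dsum_right:
  assumes "S \<in> carrier_mat (n * p) (n * p)" "T \<in> carrier_mat (n * q) (n * q)" "\<gamma> \<in> carrier_mat n (p + q)"
    "a < n" "d < p + q"
  shows "hash n (p + q) (dsum_right n p q S T) \<gamma> $$ (a, d)
    = (if d < p then hash n p S (\<gamma> * incl1 p q) $$ (a, d) else hash n q T (\<gamma> * incl2 p q) $$ (a, d - p))"
proof -
  have "hash n (p + q) (dsum_right n p q S T) \<gamma> $$ (a, d) =
    (\<Sum>b<n. (\<Sum>c<p. (if d < p then tcoeff p S a b c d else 0) * \<gamma> $$ (b, c))
     + (\<Sum>c<q. (if d < p then 0 else tcoeff q T a b c (d - p)) * \<gamma> $$ (b, p + c)))"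
    unfolding hash_index[OF assms(4,5)] sum_split_add using assms(4,5)
    by (intro arg_cong2[of _ _ _ _ "(+)"] sum.cong refl) (simp_all add: dsum_right_def tcoeff_tmat)
  also have "\<dots> = (if d < p then hash n p S (\<gamma> * incl1 p q) $$ (a, d) else hash n q T (\<gamma> * incl2 p q) $$ (a, d - p))"
    using assms by (auto simp: hash_index index_mult_incl_proj(1,2)[OF assms(3)] simp del: index_mult_mat(1) intro!: sum.cong)
  finally show ?thesis .
qed

lemma linear_functional_expand:
  fixes L :: "complex mat \<Rightarrow> complex"
  assumes add: "\<And>x y. x \<in> carrier_mat n m \<Longrightarrow> y \<in> carrier_mat n m \<Longrightarrow> L (x + y) = L x + L y"
    and smult: "\<And>c x. x \<in> carrier_mat n m \<Longrightarrow> L (c \<cdot>\<^sub>m x) = c * L x"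
    and g: "\<gamma> \<in> carrier_mat n m"
  shows "L \<gamma> = (\<Sum>b<n. \<Sum>c<m. \<gamma> $$ (b, c) * L (unit_mat n m b c))"
proof -
  define M where "M B = mat n m (\<lambda>p. if p \<in> B then \<gamma> $$ p else 0)" for B
  have M: "M B \<in> carrier_mat n m" for B by (simp add: M_def)
  have "L (M B) = (\<Sum>(b, c)\<in>B. \<gamma> $$ (b, c) * L (unit_mat n m b c))" if "finite B" for B
    using that
  proof induction
    case empty
    have "M {} = 0 \<cdot>\<^sub>m 0\<^sub>m n m" by (intro eq_matI) (auto simp: M_def)
    then show ?case using smult[of "0\<^sub>m n m" 0] by simp
  next
    case (insert p B)
    obtain b c where p: "p = (b, c)" by force
    have "M (insert p B) = \<gamma> $$ (b, c) \<cdot>\<^sub>m unit_mat n m b c + M B"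
      using insert(2) by (intro eq_matI) (auto simp: M_def unit_mat_def p)
    then have "L (M (insert p B)) = \<gamma> $$ (b, c) * L (unit_mat n m b c) + L (M B)"
      using add[of "\<gamma> $$ (b, c) \<cdot>\<^sub>m unit_mat n m b c" "M B"] smult[of "unit_mat n m b c"] M by simp
    then show ?case using insert p by simp
  qed
  from this[of "{..<n} \<times> {..<m}"] have "L (M ({..<n} \<times> {..<m})) = (\<Sum>b<n. \<Sum>c<m. \<gamma> $$ (b, c) * L (unit_mat n m b c))"
    by (simp add: sum.cartesian_product)
  moreover have "M ({..<n} \<times> {..<m}) = \<gamma>" using g by (intro eq_matI) (auto simp: M_def)
  ultimately show ?thesis by simp
qed

text \<open>Only one of the elementary tensors of matrix units contributes to a given entry of the sum.\<close>

lemma voic_partial_eq_tmat: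
  "voic_partial f n m X Y = tmat n m (\<lambda>a b c d. voic_nabla f n m X Y (unit_mat n m b c) $$ (a, d))"
proof (rule eq_matI)
  let ?v = "\<lambda>b c. voic_nabla f n m X Y (unit_mat n m b c)"
  let ?T = "tmat n m (\<lambda>a b c d. ?v b c $$ (a, d))"
  fix i j assume "i < dim_row ?T" "j < dim_col ?T"
  then have ij: "i < n * m" "j < n * m" by (auto simp: tmat_def)
  then have "m > 0" by (cases m) auto
  define a b c d where "a = i div m" and "b = j div m" and "c = i mod m" and "d = j mod m"
  have abcd: "a < n" "b < n" "c < m" "d < m"
    using ij \<open>m > 0\<close> by (auto simp: a_def b_def c_def d_def less_mult_imp_div_less)
  have k: "kron (unit_mat n n a' b') (unit_mat m m c' d') $$ (i, j)
    = (if d' = d then if c' = c then if b' = b then if a' = a then 1 else 0 else 0 else 0 else 0)" for a' b' c' d'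
    using ij abcd by (auto simp: kron_def tmat_def unit_mat_def a_def b_def c_def d_def)
  have "voic_partial f n m X Y $$ (i, j) = (\<Sum>a'<n. \<Sum>b'<n. \<Sum>c'<m. \<Sum>d'<m. ?v b' c' $$ (a', d') *
      (if d' = d then if c' = c then if b' = b then if a' = a then 1 else 0 else 0 else 0 else 0))"
    using ij by (simp add: voic_partial_def k)
  also have "\<dots> = ?v b c $$ (a, d)"
    using abcd by (simp add: if_distrib[of "\<lambda>x. _ * x"] cong: if_cong)
  also have "\<dots> = ?T $$ (i, j)" using ij by (simp add: tmat_def a_def b_def c_def d_def)
  finally show "voic_partial f n m X Y $$ (i, j) = ?T $$ (i, j)" .
qed (auto simp: voic_partial_def tmat_def)

section \<open>Fully matricial sets and intertwiners\<close>

text \<open>An open fully matricial set over an operator system, with the C*-norms on matrices.\<close>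

locale fully_matricial = matrix_cstar_norm N
  for N :: "'a::unital_cstar_algebra mat \<Rightarrow> real" +
  fixes G :: "'a set" and \<Omega> :: "nat \<Rightarrow> 'a mat set"
  assumes opsys: "operator_system G" and ofm: "open_fully_matricial N G \<Omega>"
begin

lemma Omega_mats: "X \<in> \<Omega> n \<Longrightarrow> n \<ge> 1 \<Longrightarrow> X \<in> mats G n n"
  using ofm unfolding open_fully_matricial_def by auto

lemma Omega_carrier: "X \<in> \<Omega> n \<Longrightarrow> n \<ge> 1 \<Longrightarrow> X \<in> carrier_mat n n"
  using Omega_mats by (auto simp: mats_iff)

lemma Omega_open:
  assumes "X \<in> \<Omega> n" "n \<ge> 1"
  obtains e where "e > 0" "\<And>Y. Y \<in> mats G n n \<Longrightarrow> N (Y - X) < e \<Longrightarrow> Y \<in> \<Omega> n"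
  using ofm assms unfolding open_fully_matricial_def by meson

lemma Omega_dsum:
  assumes "X \<in> \<Omega> m" "Y \<in> \<Omega> n" "m \<ge> 1" "n \<ge> 1" shows "X \<oplus>\<^sub>d Y \<in> \<Omega> (m + n)"
proof -
  have "{X \<oplus>\<^sub>d Y | X Y. X \<in> \<Omega> m \<and> Y \<in> \<Omega> n} \<subseteq> \<Omega> (m + n)"
    using ofm assms(3,4) unfolding open_fully_matricial_def by (metis (no_types, lifting) inf_le1)
  then show ?thesis using assms by blast
qed

lemma Omega_similar:
  assumes "X \<in> \<Omega> n" "n \<ge> 1" "inverse_pair n s t" shows "amp s 1 * X * amp t 1 \<in> \<Omega> n"
proof -
  have "(\<lambda>X. amp s 1 * X * amp t 1) ` \<Omega> n = \<Omega> n"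
    using ofm assms(2,3) unfolding open_fully_matricial_def by blast
  then show ?thesis using assms(1) by blast
qed

lemma F1_carrier: "f \<in> F1 \<Omega> \<Longrightarrow> X \<in> \<Omega> n \<Longrightarrow> n \<ge> 1 \<Longrightarrow> f n X \<in> carrier_mat n n"
  by (auto simp: F1_def)

lemma F1_dsum: "f \<in> F1 \<Omega> \<Longrightarrow> X \<in> \<Omega> m \<Longrightarrow> Y \<in> \<Omega> n \<Longrightarrow> m \<ge> 1 \<Longrightarrow> n \<ge> 1 \<Longrightarrow>
    f (m + n) (X \<oplus>\<^sub>d Y) = f m X \<oplus>\<^sub>d f n Y"
  by (auto simp: F1_def)

lemma F1_similar: "f \<in> F1 \<Omega> \<Longrightarrow> X \<in> \<Omega> n \<Longrightarrow> n \<ge> 1 \<Longrightarrow> inverse_pair n s t \<Longrightarrow>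
    f n (amp s 1 * X * amp t 1) = s * f n X * t"
  by (auto simp: F1_def)

text \<open>If \<open>X S = S Y\<close>, then \<open>X \<oplus> Y\<close> is fixed by conjugation with \<open>[1, S; 0, 1]\<close>, so \<open>f(X) \<oplus> f(Y)\<close> is
  fixed as well.  The off-diagonal block of that equation is the claim.\<close>

lemma F1_intertwine:
  assumes f: "f \<in> F1 \<Omega>" and X: "X \<in> \<Omega> n" and Y: "Y \<in> \<Omega> m" and nm: "n \<ge> 1" "m \<ge> 1"
    and S: "S \<in> carrier_mat n m" and eq: "X * amp S 1 = amp S 1 * Y"
  shows "f n X * S = S * f m Y"
proof -
  define s where "s = four_block_mat (1\<^sub>m n) S (0\<^sub>m m n) (1\<^sub>m m)"
  define t where "t = four_block_mat (1\<^sub>m n) (- S) (0\<^sub>m m n) (1\<^sub>m m)"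
  have c: "s \<in> carrier_mat (n + m) (n + m)" "t \<in> carrier_mat (n + m) (n + m)"
    by (auto simp: s_def t_def)
  have inv: "inverse_pair (n + m) s t"
    unfolding inverse_pair_def
  proof (intro conjI c)
    show "s * t = 1\<^sub>m (n + m)" "t * s = 1\<^sub>m (n + m)"
      using S unfolding s_def t_def
      by (subst mult_four_block_mat[of _ n n _ m _ m _ _ n _ m]; auto intro!: eq_matI)+
  qed
  note Xc = Omega_carrier[OF X nm(1)] and Yc = Omega_carrier[OF Y nm(2)]
  have com: "- (X * amp S 1) + amp S 1 * Y = 0\<^sub>m n m"
    unfolding eq using S Yc by (simp add: uminus_l_inv_mat[of _ n m])
  have 1: "amp s 1 * (X \<oplus>\<^sub>d Y) = four_block_mat X (amp S 1 * Y) (0\<^sub>m m n) Y"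
    using S Xc Yc unfolding s_def dsum_def
    by (simp add: amp_four_block[of _ n n _ m _ m] mult_four_block_mat[of _ n n _ m _ m _ _ n _ m])
  have 2: "amp t 1 = four_block_mat (1\<^sub>m n) (- amp S 1) (0\<^sub>m m n) (1\<^sub>m m)"
    using S unfolding t_def
    by (simp add: amp_four_block[of _ n n _ m _ m] amp_uminus)
  have "amp s 1 * (X \<oplus>\<^sub>d Y) * amp t 1 = X \<oplus>\<^sub>d Y"
    unfolding 1 2 using S Xc Yc com
    by (subst mult_four_block_mat[of _ n n _ m _ m _ _ n _ m]) (auto simp: dsum_def)
  with F1_similar[OF f Omega_dsum[OF X Y nm] _ inv]
  have fs: "f (n + m) (X \<oplus>\<^sub>d Y) = s * f (n + m) (X \<oplus>\<^sub>d Y) * t" using nm by simp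
  note fX = F1_carrier[OF f X nm(1)] and fY = F1_carrier[OF f Y nm(2)]
  have 3: "s * (f n X \<oplus>\<^sub>d f m Y) = four_block_mat (f n X) (S * f m Y) (0\<^sub>m m n) (f m Y)"
    using S fX fY unfolding s_def dsum_def
    by (simp add: mult_four_block_mat[of _ n n _ m _ m _ _ n _ m])
  have "f n X \<oplus>\<^sub>d f m Y = s * (f n X \<oplus>\<^sub>d f m Y) * t"
    using fs F1_dsum[OF f X Y nm] by simp
  also have "\<dots> = four_block_mat (f n X) (- (f n X * S) + S * f m Y) (0\<^sub>m m n) (f m Y)"
    unfolding 3 t_def using S fX fY
    by (subst mult_four_block_mat[of _ n n _ m _ m _ _ n _ m]) auto
  finally have e: "f n X \<oplus>\<^sub>d f m Y = four_block_mat (f n X) (- (f n X * S) + S * f m Y) (0\<^sub>m m n) (f m Y)" .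
  have c: "f n X * S \<in> carrier_mat n m" "S * f m Y \<in> carrier_mat n m" using S fX fY by auto
  show ?thesis
  proof (rule eq_matI)
    fix i j assume "i < dim_row (S * f m Y)" "j < dim_col (S * f m Y)"
    then have ij: "i < n" "j < m" using c by auto
    have "(f n X \<oplus>\<^sub>d f m Y) $$ (i, n + j) = 0"
      using ij fX fY by (simp add: dsum_def)
    moreover have "four_block_mat (f n X) (- (f n X * S) + S * f m Y) (0\<^sub>m m n) (f m Y) $$ (i, n + j)
       = - ((f n X * S) $$ (i, j)) + (S * f m Y) $$ (i, j)"
      using ij fX fY S c by (simp del: index_mult_mat(1))
    ultimately show "(f n X * S) $$ (i, j) = (S * f m Y) $$ (i, j)"
      using e by (simp del: index_mult_mat(1))
  qed (use fX fY S in auto)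
qed

section \<open>The difference-differential operator\<close>

text \<open>Right admissibility in the strong form \<open>r = 1\<close>.  A small multiple of \<open>Z\<close> is admissible because
  \<open>\<Omega>\<close> is open around \<open>X \<oplus> Y\<close>; conjugation with \<open>diag(1/r, 1)\<close> removes the factor.\<close>

lemma upper_tri_Omega:
  assumes X: "X \<in> \<Omega> n" and Y: "Y \<in> \<Omega> m" and nm: "n \<ge> 1" "m \<ge> 1" and Z: "Z \<in> mats G n m"
  shows "upper_tri X Z Y \<in> \<Omega> (n + m)"
proof -
  have nm': "n + m \<ge> 1" using nm by simp
  have c: "X \<in> carrier_mat n n" "Y \<in> carrier_mat m m" "Z \<in> carrier_mat n m"
    using Omega_carrier X Y nm Z by (auto simp: mats_iff)
  obtain e where e: "e > 0" "\<And>W. W \<in> mats G (n + m) (n + m) \<Longrightarrow> N (W - (X \<oplus>\<^sub>d Y)) < e \<Longrightarrow> W \<in> \<Omega> (n + m)"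
    using Omega_open[OF Omega_dsum[OF X Y nm] nm'] by blast
  define E where "E = upper_tri (0\<^sub>m n n) Z (0\<^sub>m m m)"
  have E: "E \<in> carrier_mat (n + m) (n + m)" by (simp add: E_def)
  \<comment> \<open>Adding \<open>1\<close> keeps the denominator positive when \<open>E = 0\<close>.\<close>
  define r where "r = e / (2 * (N E + 1))"
  have NE: "N E \<ge> 0" using N_nonneg[OF nm' E] .
  have r: "r > 0" using e(1) NE by (simp add: r_def)
  define T where "T = upper_tri X (mat_scaleC (of_real r) Z) Y"
  have "T - (X \<oplus>\<^sub>d Y) = mat_scaleC (of_real r) E"
    using c by (intro eq_matI) (auto simp: T_def E_def upper_tri_def dsum_def)
  then have "N (T - (X \<oplus>\<^sub>d Y)) = r * N E" using r by (simp add: N_scaleC[OF nm' E])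
  also have "\<dots> < e"
  proof -
    have "0 < e * N E + e * 2" using e(1) NE by (intro add_nonneg_pos) auto
    then show ?thesis using NE by (simp add: r_def field_simps)
  qed
  finally have T: "T \<in> \<Omega> (n + m)"
    using e(2)[of T] upper_tri_mats[OF opsys Omega_mats Omega_mats mat_scaleC_mats[OF opsys Z]] X Y nm
    by (simp add: T_def)
  define s where "s = four_block_mat (of_real (1/r) \<cdot>\<^sub>m 1\<^sub>m n) (0\<^sub>m n m) (0\<^sub>m m n) (1\<^sub>m m :: complex mat)"
  define t where "t = four_block_mat (of_real r \<cdot>\<^sub>m 1\<^sub>m n) (0\<^sub>m n m) (0\<^sub>m m n) (1\<^sub>m m :: complex mat)"
  have inv: "inverse_pair (n + m) s t"
    unfolding inverse_pair_def
  proof (intro conjI)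
    show "s \<in> carrier_mat (n + m) (n + m)" "t \<in> carrier_mat (n + m) (n + m)"
      by (auto simp: s_def t_def)
    show "s * t = 1\<^sub>m (n + m)" "t * s = 1\<^sub>m (n + m)"
      using r unfolding s_def t_def
      by (subst mult_four_block_mat[of _ n n _ m _ m _ _ n _ m]; auto intro!: eq_matI)+
  qed
  have s: "amp s 1 = four_block_mat (mat_scaleC (of_real (1/r)) (1\<^sub>m n)) (0\<^sub>m n m) (0\<^sub>m m n) (1\<^sub>m m)"
    unfolding s_def by (subst amp_four_block[of _ n n _ m _ m]) (auto simp: amp_smult simp del: of_real_divide)
  have t: "amp t 1 = four_block_mat (mat_scaleC (of_real r) (1\<^sub>m n)) (0\<^sub>m n m) (0\<^sub>m m n) (1\<^sub>m m)"
    unfolding t_def by (subst amp_four_block[of _ n n _ m _ m]) (auto simp: amp_smult)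
  have "amp s 1 * T = four_block_mat (mat_scaleC (of_real (1/r)) X) Z (0\<^sub>m m n) Y"
    unfolding s T_def upper_tri_def using c r
    by (subst mult_four_block_mat[of _ n n _ m _ m _ _ n _ m]) (auto simp: mat_scaleC_mult[of _ n n _ n] mat_scaleC_mult[of _ n n _ m])
  note sT = this
  have "amp s 1 * T * amp t 1 = upper_tri X Z Y"
    unfolding sT t upper_tri_def using c r
    by (subst mult_four_block_mat[of _ n n _ m _ m _ _ n _ m]) (auto simp: mat_scaleC_mult[of _ n n _ n])
  then show ?thesis using Omega_similar[OF T nm' inv] by simp
qed

text \<open>The inclusion of the first summand intertwines \<open>[X, Z; 0, Y]\<close> with \<open>X\<close>, and the projection to the
  second one intertwines \<open>Y\<close> with it; this gives the first block column and the last block row.\<close>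

lemma F1_upper_tri:
  assumes f: "f \<in> F1 \<Omega>" and X: "X \<in> \<Omega> n" and Y: "Y \<in> \<Omega> m" and nm: "n \<ge> 1" "m \<ge> 1" and Z: "Z \<in> mats G n m"
  shows "f (n + m) (upper_tri X Z Y)
    = upper_tri (f n X) (upper_right n m (f (n + m) (upper_tri X Z Y))) (f m Y)" (is "?T = _")
proof -
  have nm': "n + m \<ge> 1" using nm by simp
  have c: "X \<in> carrier_mat n n" "Y \<in> carrier_mat m m" "Z \<in> carrier_mat n m"
    using Omega_carrier X Y nm Z by (auto simp: mats_iff)
  note T = upper_tri_Omega[OF X Y nm Z]
  note fc = F1_carrier[OF f X nm(1)] F1_carrier[OF f Y nm(2)] F1_carrier[OF f T nm']
  have 1: "?T * incl1 n m = incl1 n m * f n X"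
    by (rule F1_intertwine[OF f T X nm' nm(1)]) (simp_all add: upper_tri_intertwines[OF c])
  have 2: "f m Y * proj2 n m = proj2 n m * ?T"
    by (rule F1_intertwine[OF f Y T nm(2) nm']) (simp_all add: upper_tri_intertwines[OF c])
  show ?thesis
  proof (rule eq_matI)
    fix i j assume "i < dim_row (upper_tri (f n X) (upper_right n m ?T) (f m Y))"
      "j < dim_col (upper_tri (f n X) (upper_right n m ?T) (f m Y))"
    then have ij: "i < n + m" "j < n + m" using fc by (auto simp: upper_tri_def)
    have a: "?T $$ (i, j) = (if i < n then f n X $$ (i, j) else 0)" if "j < n"
      using index_mult_incl_proj(1)[OF fc(3) ij(1) that] index_mult_incl_proj(5)[OF fc(1) ij(1) that] 1 by simp
    have b: "?T $$ (n + k, j) = (if j < n then 0 else f m Y $$ (k, j - n))" if "k < m" for k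
      using index_mult_incl_proj(4)[OF fc(3) that ij(2)] index_mult_incl_proj(8)[OF fc(2) that ij(2)] 2 by simp
    show "?T $$ (i, j) = upper_tri (f n X) (upper_right n m ?T) (f m Y) $$ (i, j)"
      using a b[of "i - n"] ij fc by (auto simp: upper_tri_def upper_right_def)
  qed (use fc in \<open>auto simp: upper_tri_def\<close>)
qed

text \<open>Naturality of the corner: \<open>diag(S, R)\<close> intertwines the two block triangular matrices.\<close>

lemma upper_right_intertwine:
  assumes f: "f \<in> F1 \<Omega>"
    and X: "X \<in> \<Omega> n" "X' \<in> \<Omega> n'" and Y: "Y \<in> \<Omega> m" "Y' \<in> \<Omega> m'"
    and nm: "n \<ge> 1" "m \<ge> 1" "n' \<ge> 1" "m' \<ge> 1"
    and Z: "Z \<in> mats G n m" "Z' \<in> mats G n' m'"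
    and S: "S \<in> carrier_mat n n'" and R: "R \<in> carrier_mat m m'"
    and XS: "X * amp S 1 = amp S 1 * X'" and YR: "Y * amp R 1 = amp R 1 * Y'"
    and ZR: "Z * amp R 1 = amp S 1 * Z'"
  shows "upper_right n m (f (n + m) (upper_tri X Z Y)) * R
    = S * upper_right n' m' (f (n' + m') (upper_tri X' Z' Y'))" (is "?U * R = S * ?U'")
proof -
  have c: "X \<in> carrier_mat n n" "Y \<in> carrier_mat m m" "Z \<in> carrier_mat n m"
    "X' \<in> carrier_mat n' n'" "Y' \<in> carrier_mat m' m'" "Z' \<in> carrier_mat n' m'"
    using Omega_carrier X Y nm Z by (auto simp: mats_iff)
  note T = upper_tri_Omega[OF X(1) Y(1) nm(1,2) Z(1)] and T' = upper_tri_Omega[OF X(2) Y(2) nm(3,4) Z(2)]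
  have nm': "n + m \<ge> 1" "n' + m' \<ge> 1" using nm by auto
  define Q where "Q = four_block_mat S (0\<^sub>m n m') (0\<^sub>m m n') R"
  have Q: "Q \<in> carrier_mat (n + m) (n' + m')" using S R by (simp add: Q_def)
  have aQ: "amp Q 1 = four_block_mat (amp S 1) (0\<^sub>m n m') (0\<^sub>m m n') (amp R 1)"
    unfolding Q_def using S R by (subst amp_four_block[of _ n n' _ m' _ m]) auto
  have 1: "upper_tri X Z Y * amp Q 1 = four_block_mat (X * amp S 1) (Z * amp R 1) (0\<^sub>m m n') (Y * amp R 1)"
    unfolding aQ using c S R by (intro upper_tri_mult_diag) auto
  have 2: "amp Q 1 * upper_tri X' Z' Y' = four_block_mat (amp S 1 * X') (amp S 1 * Z') (0\<^sub>m m n') (amp R 1 * Y')"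
    unfolding aQ using c S R by (intro diag_mult_upper_tri) auto
  have Qeq: "upper_tri X Z Y * amp Q 1 = amp Q 1 * upper_tri X' Z' Y'"
    unfolding 1 2 XS YR ZR ..
  note fc = F1_carrier[OF f X(1) nm(1)] F1_carrier[OF f Y(1) nm(2)] F1_carrier[OF f X(2) nm(3)] F1_carrier[OF f Y(2) nm(4)]
  have U: "?U \<in> carrier_mat n m" "?U' \<in> carrier_mat n' m'" by auto
  have "f (n + m) (upper_tri X Z Y) * Q = Q * f (n' + m') (upper_tri X' Z' Y')"
    by (rule F1_intertwine[OF f T T' nm' Q Qeq])
  then have eq: "upper_tri (f n X) ?U (f m Y) * Q = Q * upper_tri (f n' X') ?U' (f m' Y')"
    using F1_upper_tri[OF f X(1) Y(1) nm(1,2) Z(1)] F1_upper_tri[OF f X(2) Y(2) nm(3,4) Z(2)] by simp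
  have 3: "upper_tri (f n X) ?U (f m Y) * Q = four_block_mat (f n X * S) (?U * R) (0\<^sub>m m n') (f m Y * R)"
    unfolding Q_def by (intro upper_tri_mult_diag fc S R U)
  have 4: "Q * upper_tri (f n' X') ?U' (f m' Y') = four_block_mat (S * f n' X') (S * ?U') (0\<^sub>m m n') (R * f m' Y')"
    unfolding Q_def by (intro diag_mult_upper_tri fc S R U)
  have UR: "?U * R \<in> carrier_mat n m'" "S * ?U' \<in> carrier_mat n m'"
    using mult_carrier_mat[OF U(1) R] mult_carrier_mat[OF S U(2)] .
  show ?thesis
  proof (rule eq_matI)
    fix i j assume "i < dim_row (S * ?U')" "j < dim_col (S * ?U')"
    then have ij: "i < n" "j < m'" using UR by auto
    show "(?U * R) $$ (i, j) = (S * ?U') $$ (i, j)"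
      using arg_cong[OF eq, of "\<lambda>A. A $$ (i, n' + j)"] ij fc S R UR unfolding 3 4
      by (simp del: index_mult_mat(1))
  qed (use S R in auto)
qed

text \<open>The value does not depend on the chosen \<open>r\<close>: naturality with \<open>S = r 1\<close> and \<open>R = 1\<close> is homogeneity of
  the corner.\<close>

lemma nc_Delta_eq:
  assumes f: "f \<in> F1 \<Omega>" and X: "X \<in> \<Omega> n" and Y: "Y \<in> \<Omega> m" and nm: "n \<ge> 1" "m \<ge> 1" and Z: "Z \<in> mats G n m"
  shows "nc_Delta \<Omega> f n m X Y Z = upper_right n m (f (n + m) (upper_tri X Z Y))"
proof -
  define r where "r = (SOME r. r \<noteq> 0 \<and> upper_tri X (mat_scaleC r Z) Y \<in> \<Omega> (n + m))"
  have "\<exists>r. r \<noteq> 0 \<and> upper_tri X (mat_scaleC r Z) Y \<in> \<Omega> (n + m)"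
    by (rule exI[of _ 1]) (use upper_tri_Omega[OF X Y nm Z] in simp)
  from someI_ex[OF this] have r: "r \<noteq> 0" by (simp add: r_def)
  have c: "X \<in> carrier_mat n n" "Y \<in> carrier_mat m m" "Z \<in> carrier_mat n m"
    using Omega_carrier X Y nm Z by (auto simp: mats_iff)
  have "upper_right n m (f (n + m) (upper_tri X (mat_scaleC r Z) Y)) * 1\<^sub>m m
    = (r \<cdot>\<^sub>m 1\<^sub>m n) * upper_right n m (f (n + m) (upper_tri X Z Y))"
    using c Z by (intro upper_right_intertwine[OF f X X Y Y nm nm mat_scaleC_mats[OF opsys Z] Z])
      (auto simp: amp_smult mat_scaleC_mult[of _ n n _ n] mat_scaleC_mult[of _ n n _ m])
  then have e: "upper_right n m (f (n + m) (upper_tri X (mat_scaleC r Z) Y))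
    = r \<cdot>\<^sub>m upper_right n m (f (n + m) (upper_tri X Z Y))"
    by (simp add: mult_smult_assoc_mat[of _ n n _ m] right_mult_one_mat[of _ n m] left_mult_one_mat[of _ n m])
  show ?thesis
    unfolding nc_Delta_def r_def[symmetric] Let_def e using r by (intro eq_matI) (auto simp: upper_right_def)
qed

context
  fixes f :: "'a family1"
  assumes f: "f \<in> F1 \<Omega>"
begin

lemma Delta_one_eq:
  assumes "X \<in> \<Omega> n" "Y \<in> \<Omega> m" "n \<ge> 1" "m \<ge> 1" "\<gamma> \<in> carrier_mat n m"
  shows "nc_Delta_dir \<Omega> 1 f n m X Y \<gamma> = upper_right n m (f (n + m) (upper_tri X (amp \<gamma> 1) Y))"
  unfolding nc_Delta_dir_def using assms by (intro nc_Delta_eq[OF f] amp_one_mats[OF opsys])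

lemma Delta_one_carrier:
  assumes "X \<in> \<Omega> n" "Y \<in> \<Omega> m" "n \<ge> 1" "m \<ge> 1" "\<gamma> \<in> carrier_mat n m"
  shows "nc_Delta_dir \<Omega> 1 f n m X Y \<gamma> \<in> carrier_mat n m"
  using Delta_one_eq[OF assms] by simp

lemma Delta_one_intertwine:
  assumes X: "X \<in> \<Omega> n" "X' \<in> \<Omega> n'" and Y: "Y \<in> \<Omega> m" "Y' \<in> \<Omega> m'"
    and nm: "n \<ge> 1" "m \<ge> 1" "n' \<ge> 1" "m' \<ge> 1"
    and g: "\<gamma> \<in> carrier_mat n m" "\<gamma>' \<in> carrier_mat n' m'"
    and S: "S \<in> carrier_mat n n'" and R: "R \<in> carrier_mat m m'"
    and XS: "X * amp S 1 = amp S 1 * X'" and YR: "Y * amp R 1 = amp R 1 * Y'"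
    and gR: "\<gamma> * R = S * \<gamma>'"
  shows "nc_Delta_dir \<Omega> 1 f n m X Y \<gamma> * R = S * nc_Delta_dir \<Omega> 1 f n' m' X' Y' \<gamma>'"
  unfolding Delta_one_eq[OF X(1) Y(1) nm(1,2) g(1)] Delta_one_eq[OF X(2) Y(2) nm(3,4) g(2)]
  by (rule upper_right_intertwine[OF f X Y nm amp_one_mats[OF opsys g(1)] amp_one_mats[OF opsys g(2)] S R XS YR])
     (simp add: amp_mult[OF g(1) R, symmetric] amp_mult[OF S g(2), symmetric] gR)

lemma Delta_one_smult:
  assumes X: "X \<in> \<Omega> n" and Y: "Y \<in> \<Omega> m" and nm: "n \<ge> 1" "m \<ge> 1" and g: "\<gamma> \<in> carrier_mat n m"
  shows "nc_Delta_dir \<Omega> 1 f n m X Y (c \<cdot>\<^sub>m \<gamma>) = c \<cdot>\<^sub>m nc_Delta_dir \<Omega> 1 f n m X Y \<gamma>"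
proof -
  note cc = Omega_carrier[OF X nm(1)] Omega_carrier[OF Y nm(2)]
  have "nc_Delta_dir \<Omega> 1 f n m X Y (c \<cdot>\<^sub>m \<gamma>) * 1\<^sub>m m = (c \<cdot>\<^sub>m 1\<^sub>m n) * nc_Delta_dir \<Omega> 1 f n m X Y \<gamma>"
    using g cc by (intro Delta_one_intertwine[OF X X Y Y nm nm _ g])
      (auto simp: amp_smult mat_scaleC_mult[of _ n n _ n] mult_smult_assoc_mat[of _ n n _ m])
  then show ?thesis
    using Delta_one_carrier[OF X Y nm g] Delta_one_carrier[OF X Y nm, of "c \<cdot>\<^sub>m \<gamma>"] g
    by (simp add: mult_smult_assoc_mat[of _ n n _ m])
qed

text \<open>Additivity comes from the direct sum \<open>Y \<oplus> Y\<close> and the row \<open>[\<gamma>, \<gamma>']\<close>: the two inclusions and their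
  sum all intertwine \<open>Y \<oplus> Y\<close> with \<open>Y\<close>.\<close>

lemma Delta_one_add:
  assumes X: "X \<in> \<Omega> n" and Y: "Y \<in> \<Omega> m" and nm: "n \<ge> 1" "m \<ge> 1"
    and g: "\<gamma> \<in> carrier_mat n m" "\<gamma>' \<in> carrier_mat n m"
  shows "nc_Delta_dir \<Omega> 1 f n m X Y (\<gamma> + \<gamma>') = nc_Delta_dir \<Omega> 1 f n m X Y \<gamma> + nc_Delta_dir \<Omega> 1 f n m X Y \<gamma>'"
proof -
  note Xc = Omega_carrier[OF X nm(1)] and Yc = Omega_carrier[OF Y nm(2)]
  have mm: "m + m \<ge> 1" using nm by simp
  note YY = Omega_dsum[OF Y Y nm(2) nm(2)]
  define h where "h = mat n (m + m) (\<lambda>(i, j). if j < m then \<gamma> $$ (i, j) else \<gamma>' $$ (i, j - m))"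
  have h: "h \<in> carrier_mat n (m + m)" by (simp add: h_def)
  have hi: "h $$ (i, j) = \<gamma> $$ (i, j)" "h $$ (i, m + j) = \<gamma>' $$ (i, j)" if "i < n" "j < m" for i j
    using that by (simp_all add: h_def)
  define W where "W = nc_Delta_dir \<Omega> 1 f n (m + m) X (Y \<oplus>\<^sub>d Y) h"
  have W: "W \<in> carrier_mat n (m + m)" unfolding W_def by (rule Delta_one_carrier[OF X YY nm(1) mm h])
  have h1: "h * incl1 m m = \<gamma>"
    by (rule eq_matI) (use g h hi in \<open>auto simp: index_mult_incl_proj(1)[OF h] simp del: index_mult_mat(1)\<close>)
  have h2: "h * incl2 m m = \<gamma>'"
    by (rule eq_matI) (use g h hi in \<open>auto simp: index_mult_incl_proj(2)[OF h] simp del: index_mult_mat(1)\<close>)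
  have nat: "W * R = nc_Delta_dir \<Omega> 1 f n m X Y (h * R)"
    if R: "R \<in> carrier_mat (m + m) m" "(Y \<oplus>\<^sub>d Y) * amp R 1 = amp R 1 * Y" for R
  proof -
    have hR: "h * R \<in> carrier_mat n m" using mult_carrier_mat[OF h R(1)] .
    have "W * R = 1\<^sub>m n * nc_Delta_dir \<Omega> 1 f n m X Y (h * R)"
      unfolding W_def using Xc hR by (intro Delta_one_intertwine[OF X X YY Y nm(1) mm nm h hR _ R(1) _ R(2)]) auto
    then show ?thesis using Delta_one_carrier[OF X Y nm hR] by simp
  qed
  have amp_add: "amp (incl1 m m + incl2 m m) 1 = (incl1 m m + incl2 m m :: 'a mat)"
    by (intro eq_matI) (auto simp: incl1_def incl2_def scaleC_add_left)
  have YYc: "Y \<oplus>\<^sub>d Y \<in> carrier_mat (m + m) (m + m)" using Yc by simp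
  have "W * (incl1 m m + incl2 m m) = nc_Delta_dir \<Omega> 1 f n m X Y (h * (incl1 m m + incl2 m m))"
    by (rule nat) (simp_all add: amp_add dsum_intertwines[OF Yc Yc] mult_add_distrib_mat[OF YYc incl_proj_carrier(1,2)]
          add_mult_distrib_mat[OF incl_proj_carrier(1,2) Yc])
  moreover have "W * incl1 m m = nc_Delta_dir \<Omega> 1 f n m X Y \<gamma>"
    using nat[of "incl1 m m"] by (simp add: h1 dsum_intertwines[OF Yc Yc])
  moreover have "W * incl2 m m = nc_Delta_dir \<Omega> 1 f n m X Y \<gamma>'"
    using nat[of "incl2 m m"] by (simp add: h2 dsum_intertwines[OF Yc Yc])
  ultimately show ?thesis
    by (simp add: mult_add_distrib_mat[OF W incl_proj_carrier(1,2)] mult_add_distrib_mat[OF h incl_proj_carrier(1,2)] h1 h2)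
qed

end

section \<open>The derivations\<close>

context
  fixes f :: "'a family1"
  assumes f: "f \<in> F1 \<Omega>"
begin

lemma Delta_one_expand:
  assumes X: "X \<in> \<Omega> n" and Y: "Y \<in> \<Omega> m" and nm: "n \<ge> 1" "m \<ge> 1" and g: "\<gamma> \<in> carrier_mat n m"
    and ad: "a < n" "d < m"
  shows "nc_Delta_dir \<Omega> 1 f n m X Y \<gamma> $$ (a, d)
    = (\<Sum>b<n. \<Sum>c<m. \<gamma> $$ (b, c) * nc_Delta_dir \<Omega> 1 f n m X Y (unit_mat n m b c) $$ (a, d))"
proof (rule linear_functional_expand[of n m, OF _ _ g])
  fix x y :: "complex mat" and c assume xy: "x \<in> carrier_mat n m"
  note x = Delta_one_carrier[OF f X Y nm xy]
  show "nc_Delta_dir \<Omega> 1 f n m X Y (c \<cdot>\<^sub>m x) $$ (a, d) = c * nc_Delta_dir \<Omega> 1 f n m X Y x $$ (a, d)"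
    using x ad by (simp add: Delta_one_smult[OF f X Y nm xy])
  assume y: "y \<in> carrier_mat n m"
  show "nc_Delta_dir \<Omega> 1 f n m X Y (x + y) $$ (a, d)
    = nc_Delta_dir \<Omega> 1 f n m X Y x $$ (a, d) + nc_Delta_dir \<Omega> 1 f n m X Y y $$ (a, d)"
    using x Delta_one_carrier[OF f X Y nm y] ad by (simp add: Delta_one_add[OF f X Y nm xy y])
qed

lemma nc_partial_eq_tmat:
  assumes X: "X \<in> \<Omega> n" and Y: "Y \<in> \<Omega> m" and nm: "n \<ge> 1" "m \<ge> 1"
  shows "nc_partial \<Omega> 1 f n m X Y
      = tmat n m (\<lambda>a b c d. nc_Delta_dir \<Omega> 1 f n m X Y (unit_mat n m b c) $$ (a, d))" (is "_ = ?T")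
    and "\<gamma> \<in> carrier_mat n m \<Longrightarrow> hash n m (nc_partial \<Omega> 1 f n m X Y) \<gamma> = nc_Delta_dir \<Omega> 1 f n m X Y \<gamma>"
proof -
  have h: "hash n m ?T \<gamma> = nc_Delta_dir \<Omega> 1 f n m X Y \<gamma>" if g: "\<gamma> \<in> carrier_mat n m" for \<gamma>
  proof (rule eq_matI)
    note c = Delta_one_carrier[OF f X Y nm g]
    fix a d assume "a < dim_row (nc_Delta_dir \<Omega> 1 f n m X Y \<gamma>)" "d < dim_col (nc_Delta_dir \<Omega> 1 f n m X Y \<gamma>)"
    then have ad: "a < n" "d < m" using c by auto
    show "hash n m ?T \<gamma> $$ (a, d) = nc_Delta_dir \<Omega> 1 f n m X Y \<gamma> $$ (a, d)"
      unfolding hash_index[OF ad] Delta_one_expand[OF X Y nm g ad] using ad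
      by (intro sum.cong refl) (simp add: tcoeff_tmat)
  qed (use Delta_one_carrier[OF f X Y nm g] in \<open>auto simp: hash_def\<close>)
  show eq: "nc_partial \<Omega> 1 f n m X Y = ?T"
    unfolding nc_partial_def
  proof (rule the_equality)
    show "?T \<in> carrier_mat (n * m) (n * m) \<and> (\<forall>\<gamma>\<in>carrier_mat n m. hash n m ?T \<gamma> = nc_Delta_dir \<Omega> 1 f n m X Y \<gamma>)"
      using h by simp
    fix T assume "T \<in> carrier_mat (n * m) (n * m) \<and> (\<forall>\<gamma>\<in>carrier_mat n m. hash n m T \<gamma> = nc_Delta_dir \<Omega> 1 f n m X Y \<gamma>)"
    then show "T = ?T" using h by (intro hash_inject[of T n m ?T]) auto
  qed
  show "\<gamma> \<in> carrier_mat n m \<Longrightarrow> hash n m (nc_partial \<Omega> 1 f n m X Y) \<gamma> = nc_Delta_dir \<Omega> 1 f n m X Y \<gamma>"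
    unfolding eq by (rule h)
qed

lemma nc_partial_carrier:
  assumes "X \<in> \<Omega> n" "Y \<in> \<Omega> m" "n \<ge> 1" "m \<ge> 1"
  shows "nc_partial \<Omega> 1 f n m X Y \<in> carrier_mat (n * m) (n * m)"
  unfolding nc_partial_eq_tmat(1)[OF assms] by simp

lemma nc_partial_eqI:
  assumes "X \<in> \<Omega> n" "Y \<in> \<Omega> m" "n \<ge> 1" "m \<ge> 1" "T \<in> carrier_mat (n * m) (n * m)"
    and "\<And>\<gamma>. \<gamma> \<in> carrier_mat n m \<Longrightarrow> nc_Delta_dir \<Omega> 1 f n m X Y \<gamma> = hash n m T \<gamma>"
  shows "nc_partial \<Omega> 1 f n m X Y = T"
proof (rule hash_inject[OF nc_partial_carrier[OF assms(1-4)] assms(5)])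
  fix \<gamma> :: "complex mat" assume g: "\<gamma> \<in> carrier_mat n m"
  show "hash n m (nc_partial \<Omega> 1 f n m X Y) \<gamma> = hash n m T \<gamma>"
    unfolding nc_partial_eq_tmat(2)[OF assms(1-4) g] by (rule assms(6)[OF g])
qed

text \<open>Naturality with the two projections of \<open>X \<oplus> X'\<close>.\<close>

lemma nc_partial_dsum_left:
  assumes X: "X \<in> \<Omega> p" "X' \<in> \<Omega> q" and Y: "Y \<in> \<Omega> m" and nm: "p \<ge> 1" "q \<ge> 1" "m \<ge> 1"
  shows "nc_partial \<Omega> 1 f (p + q) m (X \<oplus>\<^sub>d X') Y
    = dsum_left p q m (nc_partial \<Omega> 1 f p m X Y) (nc_partial \<Omega> 1 f q m X' Y)"
proof (rule nc_partial_eqI[OF Omega_dsum[OF X nm(1,2)] Y _ nm(3)])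
  have pq: "p + q \<ge> 1" using nm by simp
  show "p + q \<ge> 1" by fact
  show "dsum_left p q m (nc_partial \<Omega> 1 f p m X Y) (nc_partial \<Omega> 1 f q m X' Y) \<in> carrier_mat ((p + q) * m) ((p + q) * m)"
    by (simp add: dsum_left_def)
  fix \<gamma> :: "complex mat" assume g: "\<gamma> \<in> carrier_mat (p + q) m"
  note Xc = Omega_carrier[OF X(1) nm(1)] Omega_carrier[OF X(2) nm(2)] and Yc = Omega_carrier[OF Y nm(3)]
  note XX = Omega_dsum[OF X nm(1,2)]
  let ?D = "nc_Delta_dir \<Omega> 1 f (p + q) m (X \<oplus>\<^sub>d X') Y \<gamma>"
  have Dc: "?D \<in> carrier_mat (p + q) m" by (rule Delta_one_carrier[OF f XX Y pq nm(3) g])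
  have g1: "proj1 p q * \<gamma> \<in> carrier_mat p m" and g2: "proj2 p q * \<gamma> \<in> carrier_mat q m"
    using mult_carrier_mat[OF incl_proj_carrier(3) g] mult_carrier_mat[OF incl_proj_carrier(4) g] by auto
  have "nc_Delta_dir \<Omega> 1 f p m X Y (proj1 p q * \<gamma>) * 1\<^sub>m m = proj1 p q * ?D"
    using Yc g g1 by (intro Delta_one_intertwine[OF f X(1) XX Y Y nm(1,3) pq nm(3) g1 g]) (auto simp: dsum_intertwines[OF Xc])
  then have 1: "nc_Delta_dir \<Omega> 1 f p m X Y (proj1 p q * \<gamma>) = proj1 p q * ?D"
    using Delta_one_carrier[OF f X(1) Y nm(1,3) g1] by simp
  have "nc_Delta_dir \<Omega> 1 f q m X' Y (proj2 p q * \<gamma>) * 1\<^sub>m m = proj2 p q * ?D"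
    using Yc g g2 by (intro Delta_one_intertwine[OF f X(2) XX Y Y nm(2,3) pq nm(3) g2 g]) (auto simp: dsum_intertwines[OF Xc])
  then have 2: "nc_Delta_dir \<Omega> 1 f q m X' Y (proj2 p q * \<gamma>) = proj2 p q * ?D"
    using Delta_one_carrier[OF f X(2) Y nm(2,3) g2] by simp
  show "?D = hash (p + q) m (dsum_left p q m (nc_partial \<Omega> 1 f p m X Y) (nc_partial \<Omega> 1 f q m X' Y)) \<gamma>"
    (is "_ = ?H")
  proof (rule eq_matI)
    fix a d assume "a < dim_row ?H" "d < dim_col ?H"
    then have ad: "a < p + q" "d < m" by (auto simp: hash_def)
    show "?D $$ (a, d) = ?H $$ (a, d)"
      unfolding hash_dsum_left[OF nc_partial_carrier[OF X(1) Y nm(1,3)] nc_partial_carrier[OF X(2) Y nm(2,3)] g ad]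
        nc_partial_eq_tmat(2)[OF X(1) Y nm(1,3) g1] nc_partial_eq_tmat(2)[OF X(2) Y nm(2,3) g2] 1 2
      using ad by (auto simp: index_mult_incl_proj(3,4)[OF Dc] simp del: index_mult_mat(1))
  qed (use Dc in \<open>auto simp: hash_def\<close>)
qed

text \<open>Naturality with the two inclusions into \<open>Y \<oplus> Y'\<close>.\<close>

lemma nc_partial_dsum_right:
  assumes X: "X \<in> \<Omega> n" and Y: "Y \<in> \<Omega> p" "Y' \<in> \<Omega> q" and nm: "n \<ge> 1" "p \<ge> 1" "q \<ge> 1"
  shows "nc_partial \<Omega> 1 f n (p + q) X (Y \<oplus>\<^sub>d Y')
    = dsum_right n p q (nc_partial \<Omega> 1 f n p X Y) (nc_partial \<Omega> 1 f n q X Y')"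
proof (rule nc_partial_eqI[OF X Omega_dsum[OF Y nm(2,3)] nm(1)])
  have pq: "p + q \<ge> 1" using nm by simp
  show "p + q \<ge> 1" by fact
  show "dsum_right n p q (nc_partial \<Omega> 1 f n p X Y) (nc_partial \<Omega> 1 f n q X Y') \<in> carrier_mat (n * (p + q)) (n * (p + q))"
    by (simp add: dsum_right_def)
  fix \<gamma> :: "complex mat" assume g: "\<gamma> \<in> carrier_mat n (p + q)"
  note Yc = Omega_carrier[OF Y(1) nm(2)] Omega_carrier[OF Y(2) nm(3)] and Xc = Omega_carrier[OF X nm(1)]
  note YY = Omega_dsum[OF Y nm(2,3)]
  let ?D = "nc_Delta_dir \<Omega> 1 f n (p + q) X (Y \<oplus>\<^sub>d Y') \<gamma>"
  have Dc: "?D \<in> carrier_mat n (p + q)" by (rule Delta_one_carrier[OF f X YY nm(1) pq g])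
  have g1: "\<gamma> * incl1 p q \<in> carrier_mat n p" and g2: "\<gamma> * incl2 p q \<in> carrier_mat n q"
    using mult_carrier_mat[OF g incl_proj_carrier(1)] mult_carrier_mat[OF g incl_proj_carrier(2)] by auto
  have "?D * incl1 p q = 1\<^sub>m n * nc_Delta_dir \<Omega> 1 f n p X Y (\<gamma> * incl1 p q)"
    using Xc g g1 by (intro Delta_one_intertwine[OF f X X YY Y(1) nm(1) pq nm(1,2) g g1]) (auto simp: dsum_intertwines[OF Yc])
  then have 1: "nc_Delta_dir \<Omega> 1 f n p X Y (\<gamma> * incl1 p q) = ?D * incl1 p q"
    using Delta_one_carrier[OF f X Y(1) nm(1,2) g1] by simp
  have "?D * incl2 p q = 1\<^sub>m n * nc_Delta_dir \<Omega> 1 f n q X Y' (\<gamma> * incl2 p q)"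
    using Xc g g2 by (intro Delta_one_intertwine[OF f X X YY Y(2) nm(1) pq nm(1,3) g g2]) (auto simp: dsum_intertwines[OF Yc])
  then have 2: "nc_Delta_dir \<Omega> 1 f n q X Y' (\<gamma> * incl2 p q) = ?D * incl2 p q"
    using Delta_one_carrier[OF f X Y(2) nm(1,3) g2] by simp
  show "?D = hash n (p + q) (dsum_right n p q (nc_partial \<Omega> 1 f n p X Y) (nc_partial \<Omega> 1 f n q X Y')) \<gamma>"
    (is "_ = ?H")
  proof (rule eq_matI)
    fix a d assume "a < dim_row ?H" "d < dim_col ?H"
    then have ad: "a < n" "d < p + q" by (auto simp: hash_def)
    show "?D $$ (a, d) = ?H $$ (a, d)"
      unfolding hash_dsum_right[OF nc_partial_carrier[OF X Y(1) nm(1,2)] nc_partial_carrier[OF X Y(2) nm(1,3)] g ad]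
        nc_partial_eq_tmat(2)[OF X Y(1) nm(1,2) g1] nc_partial_eq_tmat(2)[OF X Y(2) nm(1,3) g2] 1 2
      using ad by (auto simp: index_mult_incl_proj(1,2)[OF Dc] simp del: index_mult_mat(1))
  qed (use Dc in \<open>auto simp: hash_def\<close>)
qed

lemma nc_partial_similar_left:
  assumes X: "X \<in> \<Omega> n" and Y: "Y \<in> \<Omega> m" and nm: "n \<ge> 1" "m \<ge> 1" and inv: "inverse_pair n s t"
  shows "nc_partial \<Omega> 1 f n m (amp s 1 * X * amp t 1) Y
    = kron s (1\<^sub>m m) * nc_partial \<Omega> 1 f n m X Y * kron t (1\<^sub>m m)" (is "_ = ?s * ?T * ?t")
proof (rule nc_partial_eqI[OF Omega_similar[OF X nm(1) inv] Y nm])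
  have st: "s \<in> carrier_mat n n" "t \<in> carrier_mat n n" "s * t = 1\<^sub>m n"
    using inv by (auto simp: inverse_pair_def)
  note Xc = Omega_carrier[OF X nm(1)] and Yc = Omega_carrier[OF Y nm(2)]
  note Tc = nc_partial_carrier[OF X Y nm]
  have sc: "?s \<in> carrier_mat (n * m) (n * m)" "?t \<in> carrier_mat (n * m) (n * m)" using st by auto
  have sTc: "?s * ?T \<in> carrier_mat (n * m) (n * m)" using mult_carrier_mat[OF sc(1) Tc] .
  show "?s * ?T * ?t \<in> carrier_mat (n * m) (n * m)" by (rule mult_carrier_mat[OF sTc sc(2)])
  fix \<gamma> :: "complex mat" assume g: "\<gamma> \<in> carrier_mat n m"
  have tg: "t * \<gamma> \<in> carrier_mat n m" using mult_carrier_mat[OF st(2) g] .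
  note D = Delta_one_carrier[OF f Omega_similar[OF X nm(1) inv] Y nm g]
  have "s * (t * \<gamma>) = \<gamma>" using assoc_mult_mat[OF st(1,2) g] st(3) g by simp
  then have "nc_Delta_dir \<Omega> 1 f n m (amp s 1 * X * amp t 1) Y \<gamma> * 1\<^sub>m m = s * nc_Delta_dir \<Omega> 1 f n m X Y (t * \<gamma>)"
    using Yc g st by (intro Delta_one_intertwine[OF f Omega_similar[OF X nm(1) inv] X Y Y nm nm g tg st(1) _ similar_intertwines[OF Xc inv]]) auto
  also have "\<dots> = s * hash n m ?T (t * \<gamma>)" by (simp add: nc_partial_eq_tmat(2)[OF X Y nm tg])
  also have "\<dots> = hash n m (?s * ?T * ?t) \<gamma>"
    by (simp only: hash_kron_legs(2)[OF sTc g st(2)] hash_kron_legs(1)[OF Tc tg st(1)])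
  finally show "nc_Delta_dir \<Omega> 1 f n m (amp s 1 * X * amp t 1) Y \<gamma> = hash n m (?s * ?T * ?t) \<gamma>"
    using D by simp
qed

lemma nc_partial_similar_right:
  assumes X: "X \<in> \<Omega> n" and Y: "Y \<in> \<Omega> m" and nm: "n \<ge> 1" "m \<ge> 1" and inv: "inverse_pair m s t"
  shows "nc_partial \<Omega> 1 f n m X (amp s 1 * Y * amp t 1)
    = kron (1\<^sub>m n) s * nc_partial \<Omega> 1 f n m X Y * kron (1\<^sub>m n) t" (is "_ = ?s * ?T * ?t")
proof (rule nc_partial_eqI[OF X Omega_similar[OF Y nm(2) inv] nm])
  have st: "s \<in> carrier_mat m m" "t \<in> carrier_mat m m" "s * t = 1\<^sub>m m"
    using inv by (auto simp: inverse_pair_def)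
  note Xc = Omega_carrier[OF X nm(1)] and Yc = Omega_carrier[OF Y nm(2)]
  note Tc = nc_partial_carrier[OF X Y nm]
  have sc: "?s \<in> carrier_mat (n * m) (n * m)" "?t \<in> carrier_mat (n * m) (n * m)" using st by auto
  have sTc: "?s * ?T \<in> carrier_mat (n * m) (n * m)" using mult_carrier_mat[OF sc(1) Tc] .
  show "?s * ?T * ?t \<in> carrier_mat (n * m) (n * m)" by (rule mult_carrier_mat[OF sTc sc(2)])
  fix \<gamma> :: "complex mat" assume g: "\<gamma> \<in> carrier_mat n m"
  have gs: "\<gamma> * s \<in> carrier_mat n m" using mult_carrier_mat[OF g st(1)] .
  let ?D = "nc_Delta_dir \<Omega> 1 f n m X (amp s 1 * Y * amp t 1) \<gamma>"
  have D: "?D \<in> carrier_mat n m" by (rule Delta_one_carrier[OF f X Omega_similar[OF Y nm(2) inv] nm g])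
  have "?D * s = 1\<^sub>m n * nc_Delta_dir \<Omega> 1 f n m X Y (\<gamma> * s)"
    using Xc gs by (intro Delta_one_intertwine[OF f X X Omega_similar[OF Y nm(2) inv] Y nm nm g gs _ st(1) _ similar_intertwines[OF Yc inv]]) auto
  also have "\<dots> = hash n m ?T (\<gamma> * s)"
    unfolding nc_partial_eq_tmat(2)[OF X Y nm gs] by (rule left_mult_one_mat[OF Delta_one_carrier[OF f X Y nm gs]])
  finally have "?D * s * t = hash n m (?s * ?T * ?t) \<gamma>"
    by (simp only: hash_kron_legs(4)[OF sTc g st(2)] hash_kron_legs(3)[OF Tc g st(1)])
  moreover have "?D * s * t = ?D" using assoc_mult_mat[OF D st(1,2)] st(3) D by simp
  ultimately show "?D = hash n m (?s * ?T * ?t) \<gamma>" by simp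
qed

lemma nc_partial_F2: "nc_partial \<Omega> 1 f \<in> F2 \<Omega>"
  unfolding F2_def
  by (simp add: nc_partial_carrier nc_partial_dsum_left nc_partial_dsum_right nc_partial_similar_left nc_partial_similar_right)

text \<open>The derivative at \<open>0\<close> defining \<open>voic_nabla\<close> is that of a function linear in \<open>\<epsilon>\<close>; no
  analyticity is needed.\<close>

lemma voic_nabla_eq_Delta_one:
  assumes X: "X \<in> \<Omega> n" and Y: "Y \<in> \<Omega> m" and nm: "n \<ge> 1" "m \<ge> 1" and g: "\<gamma> \<in> carrier_mat n m"
  shows "voic_nabla f n m X Y \<gamma> = nc_Delta_dir \<Omega> 1 f n m X Y \<gamma>"
proof (rule eq_matI)
  let ?D = "nc_Delta_dir \<Omega> 1 f n m X Y \<gamma>"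
  note D = Delta_one_carrier[OF f X Y nm g]
  fix i j assume "i < dim_row ?D" "j < dim_col ?D"
  then have ij: "i < n" "j < m" using D by auto
  have "f (n + m) (upper_tri X (mat_scaleC \<epsilon> (amp \<gamma> 1)) Y) $$ (i, n + j) = ?D $$ (i, j) * \<epsilon>" for \<epsilon>
  proof -
    have "upper_right n m (f (n + m) (upper_tri X (mat_scaleC \<epsilon> (amp \<gamma> 1)) Y)) = \<epsilon> \<cdot>\<^sub>m ?D"
      using Delta_one_eq[OF f X Y nm, of "\<epsilon> \<cdot>\<^sub>m \<gamma>"] g Delta_one_smult[OF f X Y nm g, of \<epsilon>] by (simp add: amp_smult)
    from arg_cong[OF this, of "\<lambda>A. A $$ (i, j)"] show ?thesis
      using ij D by (simp add: upper_right_def mult.commute)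
  qed
  moreover have "deriv (\<lambda>\<epsilon>. ?D $$ (i, j) * \<epsilon>) 0 = ?D $$ (i, j)"
    by (rule DERIV_imp_deriv) (auto intro!: derivative_eq_intros)
  ultimately show "voic_nabla f n m X Y \<gamma> $$ (i, j) = ?D $$ (i, j)"
    using ij by (simp add: voic_nabla_def upper_right_def)
qed (use Delta_one_carrier[OF f X Y nm g] in \<open>auto simp: voic_nabla_def\<close>)

lemma nc_partial_eq_voic_partial:
  assumes "X \<in> \<Omega> n" "Y \<in> \<Omega> m" "n \<ge> 1" "m \<ge> 1"
  shows "nc_partial \<Omega> 1 f n m X Y = voic_partial f n m X Y"
  unfolding nc_partial_eq_tmat(1)[OF assms] voic_partial_eq_tmat
  by (simp add: voic_nabla_eq_Delta_one[OF assms])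

lemma voic_partial_F2: "voic_partial f \<in> F2 \<Omega>"
  using nc_partial_F2 unfolding F2_def
  by (simp add: nc_partial_eq_voic_partial Omega_dsum Omega_similar)

end

text \<open>If \<open>D\<close> is the derivative of an entry of \<open>f\<close> at \<open>[X, Z; 0, Y]\<close>, then \<open>(h, h') \<mapsto> D (h \<oplus> h')\<close> is the
  derivative of the corresponding entry of \<open>\<partial>f\<close> at \<open>(X, Y)\<close>; the norm estimate for direct sums bounds
  the remainder.\<close>

lemma voic_partial_A2:
  assumes fA: "f \<in> A1 N G \<Omega>"
  shows "voic_partial f \<in> A2 N G \<Omega>"
proof -
  have f: "f \<in> F1 \<Omega>" and an: "\<And>n i j. n \<ge> 1 \<Longrightarrow> i < n \<Longrightarrow> j < n \<Longrightarrow>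
     analytic_fun_on (mats G n n) (+) mat_scaleC N (\<Omega> n) (\<lambda>X. f n X $$ (i, j))"
    using fA by (auto simp: A1_def)
  have "analytic_fun_on (mats G n n \<times> mats G m m)
       (\<lambda>(X, Y) (X', Y'). (X + X', Y + Y'))
       (\<lambda>c (X, Y). (mat_scaleC c X, mat_scaleC c Y))
       (\<lambda>(X, Y). max (N X) (N Y))
       (\<Omega> n \<times> \<Omega> m) (\<lambda>(X, Y). voic_partial f n m X Y $$ (i, j))"
    if nm: "n \<ge> 1" "m \<ge> 1" and ij: "i < n * m" "j < n * m" for n m i j
  proof -
    have nm': "n + m \<ge> 1" using nm by simp
    define Z where "Z = amp (unit_mat n m (j div m) (i mod m)) (1::'a)"
    have Z: "Z \<in> mats G n m" unfolding Z_def by (rule amp_one_mats[OF opsys]) simp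
    have Zc: "Z \<in> carrier_mat n m" using Z by (simp add: mats_iff)
    define k l where "k = i div m" and "l = n + j mod m"
    have kl: "k < n + m" "l < n + m" "k < n" "j mod m < m"
      using ij nm less_mult_imp_div_less[of i n m] by (auto simp: k_def l_def)
    have entry: "voic_partial f n m X Y $$ (i, j) = f (n + m) (upper_tri X Z Y) $$ (k, l)"
      if XY: "X \<in> \<Omega> n" "Y \<in> \<Omega> m" for X Y
    proof -
      have "voic_partial f n m X Y $$ (i, j)
        = nc_Delta_dir \<Omega> 1 f n m X Y (unit_mat n m (j div m) (i mod m)) $$ (k, j mod m)"
        using ij by (simp add: voic_partial_eq_tmat voic_nabla_eq_Delta_one[OF f XY nm] tmat_def k_def)
      also have "\<dots> = f (n + m) (upper_tri X Z Y) $$ (k, l)"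
        using kl by (simp add: Delta_one_eq[OF f XY nm] upper_right_def Z_def l_def)
      finally show ?thesis .
    qed
    have "\<exists>D. (\<forall>h\<in>mats G n n \<times> mats G m m. \<forall>h'\<in>mats G n n \<times> mats G m m.
        D ((\<lambda>(X, Y) (X', Y'). (X + X', Y + Y')) h h') = D h + D h') \<and>
       (\<forall>c. \<forall>h\<in>mats G n n \<times> mats G m m. D ((\<lambda>(X, Y). (mat_scaleC c X, mat_scaleC c Y)) h) = c * D h) \<and>
       (\<exists>B. \<forall>h\<in>mats G n n \<times> mats G m m. cmod (D h) \<le> B * (\<lambda>(X, Y). max (N X) (N Y)) h) \<and>
       (\<forall>e>0. \<exists>d>0. \<forall>h\<in>mats G n n \<times> mats G m m. (\<lambda>(X, Y) (X', Y'). (X + X', Y + Y')) (X, Y) h \<in> \<Omega> n \<times> \<Omega> m \<and>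
            (\<lambda>(X, Y). max (N X) (N Y)) h < d \<longrightarrow>
          cmod ((\<lambda>(X, Y). voic_partial f n m X Y $$ (i, j)) ((\<lambda>(X, Y) (X', Y'). (X + X', Y + Y')) (X, Y) h)
            - (\<lambda>(X, Y). voic_partial f n m X Y $$ (i, j)) (X, Y) - D h)
          \<le> e * (\<lambda>(X, Y). max (N X) (N Y)) h)"
      if XY: "X \<in> \<Omega> n" "Y \<in> \<Omega> m" for X Y
    proof -
      note c = Omega_carrier[OF XY(1) nm(1)] Omega_carrier[OF XY(2) nm(2)]
      note T = upper_tri_Omega[OF XY nm Z]
      from an[OF nm' kl(1,2), unfolded analytic_fun_on_def, THEN bspec, OF T]
      obtain D B where D: "\<forall>h\<in>mats G (n + m) (n + m). \<forall>k\<in>mats G (n + m) (n + m). D (h + k) = D h + D k"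
          "\<forall>c. \<forall>h\<in>mats G (n + m) (n + m). D (mat_scaleC c h) = c * D h" "\<forall>h\<in>mats G (n + m) (n + m). cmod (D h) \<le> B * N h"
          "\<forall>e>0. \<exists>d>0. \<forall>h\<in>mats G (n + m) (n + m). upper_tri X Z Y + h \<in> \<Omega> (n + m) \<and> N h < d \<longrightarrow>
            cmod (f (n + m) (upper_tri X Z Y + h) $$ (k, l) - f (n + m) (upper_tri X Z Y) $$ (k, l) - D h) \<le> e * N h"
        by (elim exE conjE) (rule that)
      note Dadd = D(1)[rule_format] and Dsc = D(2)[rule_format] and DB = D(3)[rule_format] and Dlim = D(4)[THEN spec, THEN mp]
      have dm: "h \<oplus>\<^sub>d h' \<in> mats G (n + m) (n + m)" if "h \<in> mats G n n" "h' \<in> mats G m m" for h h'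
        using that opsys by (auto simp: mats_iff dsum_def operator_system_zero)
      have dN: "N (h \<oplus>\<^sub>d h') \<le> max (N h) (N h')" "0 \<le> N (h \<oplus>\<^sub>d h')"
        if "h \<in> mats G n n" "h' \<in> mats G m m" for h h'
        using that N_dsum[OF nm, of h h'] N_nonneg[OF nm', of "h \<oplus>\<^sub>d h'"] by (simp_all add: mats_iff)
      show ?thesis
      proof (intro exI[of _ "\<lambda>(h, h'). D (h \<oplus>\<^sub>d h')"] conjI allI impI ballI)
        fix p q assume "p \<in> mats G n n \<times> mats G m m" "q \<in> mats G n n \<times> mats G m m"
        then obtain h h' g g' where pq: "p = (h, h')" "q = (g, g')"
          and m: "h \<in> mats G n n" "h' \<in> mats G m m" "g \<in> mats G n n" "g' \<in> mats G m m" by auto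
        have "(h + g) \<oplus>\<^sub>d (h' + g') = (h \<oplus>\<^sub>d h') + (g \<oplus>\<^sub>d g')"
          using m by (intro eq_matI) (auto simp: dsum_def mats_iff)
        then show "(case (case p of (X, Y) \<Rightarrow> \<lambda>(X', Y'). (X + X', Y + Y')) q of (h, h') \<Rightarrow> D (h \<oplus>\<^sub>d h'))
          = (case p of (h, h') \<Rightarrow> D (h \<oplus>\<^sub>d h')) + (case q of (h, h') \<Rightarrow> D (h \<oplus>\<^sub>d h'))"
          using Dadd[OF dm[OF m(1,2)] dm[OF m(3,4)]] by (simp add: pq)
      next
        fix c p assume "p \<in> mats G n n \<times> mats G m m"
        then obtain h h' where p: "p = (h, h')" and m: "h \<in> mats G n n" "h' \<in> mats G m m" by auto
        have "mat_scaleC c h \<oplus>\<^sub>d mat_scaleC c h' = mat_scaleC c (h \<oplus>\<^sub>d h')"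
          using m by (intro eq_matI) (auto simp: dsum_def)
        then show "(case (case p of (X, Y) \<Rightarrow> (mat_scaleC c X, mat_scaleC c Y)) of (h, h') \<Rightarrow> D (h \<oplus>\<^sub>d h'))
          = c * (case p of (h, h') \<Rightarrow> D (h \<oplus>\<^sub>d h'))"
          using Dsc[OF dm[OF m]] by (simp add: p)
      next
        have "cmod (D (h \<oplus>\<^sub>d h')) \<le> \<bar>B\<bar> * max (N h) (N h')"
          if m: "h \<in> mats G n n" "h' \<in> mats G m m" for h h'
        proof -
          have "cmod (D (h \<oplus>\<^sub>d h')) \<le> B * N (h \<oplus>\<^sub>d h')" by (rule DB[OF dm[OF m]])
          also have "\<dots> \<le> \<bar>B\<bar> * N (h \<oplus>\<^sub>d h')" using dN(2)[OF m] by (intro mult_right_mono) auto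
          also have "\<dots> \<le> \<bar>B\<bar> * max (N h) (N h')" using dN(1)[OF m] by (intro mult_left_mono) auto
          finally show ?thesis .
        qed
        then show "\<exists>B. \<forall>p\<in>mats G n n \<times> mats G m m.
            cmod (case p of (h, h') \<Rightarrow> D (h \<oplus>\<^sub>d h')) \<le> B * (case p of (X, Y) \<Rightarrow> max (N X) (N Y))"
          by (intro exI[of _ "\<bar>B\<bar>"]) auto
      next
        fix e :: real assume e: "e > 0"
        obtain d where d: "d > 0" "\<And>h. h \<in> mats G (n + m) (n + m) \<Longrightarrow> upper_tri X Z Y + h \<in> \<Omega> (n + m) \<Longrightarrow> N h < d \<Longrightarrow>
          cmod (f (n + m) (upper_tri X Z Y + h) $$ (k, l) - f (n + m) (upper_tri X Z Y) $$ (k, l) - D h) \<le> e * N h"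
          using Dlim[OF e] by blast
        have "cmod (voic_partial f n m (X + h) (Y + h') $$ (i, j) - voic_partial f n m X Y $$ (i, j) - D (h \<oplus>\<^sub>d h'))
            \<le> e * max (N h) (N h')"
          if m: "h \<in> mats G n n" "h' \<in> mats G m m" and XY': "X + h \<in> \<Omega> n" "Y + h' \<in> \<Omega> m"
            and less: "max (N h) (N h') < d" for h h'
        proof -
          have eq: "upper_tri (X + h) Z (Y + h') = upper_tri X Z Y + (h \<oplus>\<^sub>d h')"
            using m c Zc by (intro eq_matI) (auto simp: upper_tri_def dsum_def mats_iff)
          have "cmod (voic_partial f n m (X + h) (Y + h') $$ (i, j) - voic_partial f n m X Y $$ (i, j) - D (h \<oplus>\<^sub>d h'))
            \<le> e * N (h \<oplus>\<^sub>d h')"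
            unfolding entry[OF XY] entry[OF XY'] eq using le_less_trans[OF dN(1)[OF m] less] upper_tri_Omega[OF XY' nm Z]
            by (intro d(2) dm[OF m]) (simp_all add: eq)
          also have "\<dots> \<le> e * max (N h) (N h')" using dN(1)[OF m] e by (intro mult_left_mono) auto
          finally show ?thesis .
        qed
        then show "\<exists>d>0. \<forall>h\<in>mats G n n \<times> mats G m m. (\<lambda>(X, Y) (X', Y'). (X + X', Y + Y')) (X, Y) h \<in> \<Omega> n \<times> \<Omega> m \<and>
            (\<lambda>(X, Y). max (N X) (N Y)) h < d \<longrightarrow>
          cmod ((\<lambda>(X, Y). voic_partial f n m X Y $$ (i, j)) ((\<lambda>(X, Y) (X', Y'). (X + X', Y + Y')) (X, Y) h)
            - (\<lambda>(X, Y). voic_partial f n m X Y $$ (i, j)) (X, Y) - (\<lambda>(h, h'). D (h \<oplus>\<^sub>d h')) h)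
          \<le> e * (\<lambda>(X, Y). max (N X) (N Y)) h"
          using d(1) by (intro exI[of _ d]) auto
      qed
    qed
    then show ?thesis unfolding analytic_fun_on_def by blast
  qed
  then show ?thesis using voic_partial_F2[OF f] by (simp add: A2_def)
qed

end

theorem proposition10p19:
  fixes G :: "'a::unital_cstar_algebra set"
    and N :: "'a mat \<Rightarrow> real"
    and \<Omega> :: "nat \<Rightarrow> 'a mat set"
  assumes "operator_system G"
    and "cstar_matrix_norm N"
    and "open_fully_matricial N G \<Omega>"
  shows "nc_partial \<Omega> 1 \<in> F1 \<Omega> \<rightarrow> F2 \<Omega> \<and>
    voic_partial \<in> A1 N G \<Omega> \<rightarrow> A2 N G \<Omega> \<and>
    (\<forall>f\<in>A1 N G \<Omega>. \<forall>n\<ge>1. \<forall>m\<ge>1. \<forall>X\<in>\<Omega> n. \<forall>Y\<in>\<Omega> m.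
       nc_partial \<Omega> 1 f n m X Y = voic_partial f n m X Y) \<and>
    (\<forall>f\<in>A1 N G \<Omega>. \<forall>n\<ge>1. \<forall>m\<ge>1. \<forall>X\<in>\<Omega> n. \<forall>Y\<in>\<Omega> m. \<forall>\<gamma>\<in>carrier_mat n m.
       nc_Delta_dir \<Omega> 1 f n m X Y \<gamma> = voic_nabla f n m X Y \<gamma>)"
proof -
  interpret fully_matricial N G \<Omega> using assms by unfold_locales
  have F1: "f \<in> F1 \<Omega>" if "f \<in> A1 N G \<Omega>" for f using that by (simp add: A1_def)
  show ?thesis
    using nc_partial_F2 voic_partial_A2 nc_partial_eq_voic_partial[OF F1] voic_nabla_eq_Delta_one[OF F1]
    by auto
qed

end
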